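(* Given a finite free skew Boolean algebra on $n\ge 1$ generators, whether left-handed, right-handed or two-sided (i.e. free in the variety of left-handed, of right-handed, or of all skew Boolean algebras), its center forms a Boolean algebra of order $2^n$. In the case of an infinite free algebra (one free on an infinite set of generators, in any of these three varieties), the center is just $\{0\}$.
   Context: A skew lattice is an algebra $(S;\wedge,\vee)$ with associative binary operations satisfying $x\wedge(x\vee y)=x=(y\vee x)\wedge x$ and $x\vee(x\wedge y)=x=(y\wedge x)\vee x$. A skew Boolean algebra is an algebra $(S;\wedge,\vee,\setminus,0)$ such that $(S;\wedge,\vee)$ is a skew lattice satisfying $x\wedge(y\vee z)=(x\wedge y)\vee(x\wedge z)$ and $(x\vee y)\wedge z=(x\wedge z)\vee(y\wedge z)$, $0$ satisfies $0\wedge x=0=x\wedge 0$ and $0\vee x=x=x\vee 0$, and $(x\wedge y\wedge x)\vee(x\setminus y)=x$, $(x\wedge y\wedge x)\wedge(x\setminus y)=0=(x\setminus y)\wedge(x\wedge y\wedge x)$. It is left-handed if $x\wedge y\wedge x=x\wedge y$ and $x\vee y\vee x=y\vee x$ hold, right-handed if $x\wedge y\wedge x=y\wedge x$ and $x\vee y\vee x=x\vee y$ hold. Each of these classes is a variety, and free algebras are taken in the respective variety. The center of a skew lattice is the set of elements that both $\wedge$-commute and $\vee$-commute with all elements. *)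

theory Defs
  imports "HOL-Algebra.Congruence"
begin

section \<open>Skew lattices and skew Boolean algebras\<close>

record 'a skew_lat = "'a partial_object" +
  skew_meet :: "'a \<Rightarrow> 'a \<Rightarrow> 'a"  (infixl \<open>\<^bold>\<and>\<index>\<close> 70)
  skew_join :: "'a \<Rightarrow> 'a \<Rightarrow> 'a"  (infixl \<open>\<^bold>\<or>\<index>\<close> 65)

record 'a skew_ba = "'a skew_lat" +
  skew_diff :: "'a \<Rightarrow> 'a \<Rightarrow> 'a"  (infixl \<open>\<setminus>\<index>\<close> 70)
  skew_zero :: 'a  (\<open>\<^bold>0\<index>\<close>)

locale skew_lattice =
  fixes S (structure)
  assumes meet_closed: "\<lbrakk>x \<in> carrier S; y \<in> carrier S\<rbrakk> \<Longrightarrow> x \<^bold>\<and> y \<in> carrier S"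
    and join_closed: "\<lbrakk>x \<in> carrier S; y \<in> carrier S\<rbrakk> \<Longrightarrow> x \<^bold>\<or> y \<in> carrier S"
    and meet_assoc: "\<lbrakk>x \<in> carrier S; y \<in> carrier S; z \<in> carrier S\<rbrakk> \<Longrightarrow>
      (x \<^bold>\<and> y) \<^bold>\<and> z = x \<^bold>\<and> (y \<^bold>\<and> z)"
    and join_assoc: "\<lbrakk>x \<in> carrier S; y \<in> carrier S; z \<in> carrier S\<rbrakk> \<Longrightarrow>
      (x \<^bold>\<or> y) \<^bold>\<or> z = x \<^bold>\<or> (y \<^bold>\<or> z)"
    and meet_absorb_left: "\<lbrakk>x \<in> carrier S; y \<in> carrier S\<rbrakk> \<Longrightarrow> x \<^bold>\<and> (x \<^bold>\<or> y) = x"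
    and meet_absorb_right: "\<lbrakk>x \<in> carrier S; y \<in> carrier S\<rbrakk> \<Longrightarrow> (y \<^bold>\<or> x) \<^bold>\<and> x = x"
    and join_absorb_left: "\<lbrakk>x \<in> carrier S; y \<in> carrier S\<rbrakk> \<Longrightarrow> x \<^bold>\<or> (x \<^bold>\<and> y) = x"
    and join_absorb_right: "\<lbrakk>x \<in> carrier S; y \<in> carrier S\<rbrakk> \<Longrightarrow> (y \<^bold>\<and> x) \<^bold>\<or> x = x"

locale skew_boolean_algebra = skew_lattice S for S (structure) +
  assumes diff_closed: "\<lbrakk>x \<in> carrier S; y \<in> carrier S\<rbrakk> \<Longrightarrow> x \<setminus> y \<in> carrier S"
    and zero_closed: "\<^bold>0 \<in> carrier S"
    and meet_join_distrib: "\<lbrakk>x \<in> carrier S; y \<in> carrier S; z \<in> carrier S\<rbrakk> \<Longrightarrow>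
      x \<^bold>\<and> (y \<^bold>\<or> z) = (x \<^bold>\<and> y) \<^bold>\<or> (x \<^bold>\<and> z)"
    and join_meet_distrib: "\<lbrakk>x \<in> carrier S; y \<in> carrier S; z \<in> carrier S\<rbrakk> \<Longrightarrow>
      (x \<^bold>\<or> y) \<^bold>\<and> z = (x \<^bold>\<and> z) \<^bold>\<or> (y \<^bold>\<and> z)"
    and zero_meet: "x \<in> carrier S \<Longrightarrow> \<^bold>0 \<^bold>\<and> x = \<^bold>0"
    and meet_zero: "x \<in> carrier S \<Longrightarrow> x \<^bold>\<and> \<^bold>0 = \<^bold>0"
    and zero_join: "x \<in> carrier S \<Longrightarrow> \<^bold>0 \<^bold>\<or> x = x"
    and join_zero: "x \<in> carrier S \<Longrightarrow> x \<^bold>\<or> \<^bold>0 = x"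
    and diff_join: "\<lbrakk>x \<in> carrier S; y \<in> carrier S\<rbrakk> \<Longrightarrow>
      (x \<^bold>\<and> y \<^bold>\<and> x) \<^bold>\<or> (x \<setminus> y) = x"
    and meet_diff: "\<lbrakk>x \<in> carrier S; y \<in> carrier S\<rbrakk> \<Longrightarrow>
      (x \<^bold>\<and> y \<^bold>\<and> x) \<^bold>\<and> (x \<setminus> y) = \<^bold>0"
    and diff_meet: "\<lbrakk>x \<in> carrier S; y \<in> carrier S\<rbrakk> \<Longrightarrow>
      (x \<setminus> y) \<^bold>\<and> (x \<^bold>\<and> y \<^bold>\<and> x) = \<^bold>0"

definition left_handed :: "('a, 'b) skew_lat_scheme \<Rightarrow> bool" where
  "left_handed S \<longleftrightarrow> (\<forall>x\<in>carrier S. \<forall>y\<in>carrier S.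
     x \<^bold>\<and>\<^bsub>S\<^esub> y \<^bold>\<and>\<^bsub>S\<^esub> x = x \<^bold>\<and>\<^bsub>S\<^esub> y \<and> x \<^bold>\<or>\<^bsub>S\<^esub> y \<^bold>\<or>\<^bsub>S\<^esub> x = y \<^bold>\<or>\<^bsub>S\<^esub> x)"

definition right_handed :: "('a, 'b) skew_lat_scheme \<Rightarrow> bool" where
  "right_handed S \<longleftrightarrow> (\<forall>x\<in>carrier S. \<forall>y\<in>carrier S.
     x \<^bold>\<and>\<^bsub>S\<^esub> y \<^bold>\<and>\<^bsub>S\<^esub> x = y \<^bold>\<and>\<^bsub>S\<^esub> x \<and> x \<^bold>\<or>\<^bsub>S\<^esub> y \<^bold>\<or>\<^bsub>S\<^esub> x = x \<^bold>\<or>\<^bsub>S\<^esub> y)"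

definition center :: "('a, 'b) skew_lat_scheme \<Rightarrow> 'a set" where
  "center S = {c \<in> carrier S. \<forall>x\<in>carrier S.
     c \<^bold>\<and>\<^bsub>S\<^esub> x = x \<^bold>\<and>\<^bsub>S\<^esub> c \<and> c \<^bold>\<or>\<^bsub>S\<^esub> x = x \<^bold>\<or>\<^bsub>S\<^esub> c}"

text \<open>The axioms of \<^locale>\<open>abstract_boolean_algebra\<close>, relativised to a carrier set.\<close>

locale boolean_algebra_on =
  fixes B :: "'a set" and conj disj :: "'a \<Rightarrow> 'a \<Rightarrow> 'a" and compl :: "'a \<Rightarrow> 'a" and zero one :: 'a
  assumes "\<lbrakk>x \<in> B; y \<in> B\<rbrakk> \<Longrightarrow> conj x y \<in> B"
    and "\<lbrakk>x \<in> B; y \<in> B\<rbrakk> \<Longrightarrow> disj x y \<in> B"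
    and "x \<in> B \<Longrightarrow> compl x \<in> B"
    and "zero \<in> B"
    and "one \<in> B"
    and "\<lbrakk>x \<in> B; y \<in> B; z \<in> B\<rbrakk> \<Longrightarrow> conj (conj x y) z = conj x (conj y z)"
    and "\<lbrakk>x \<in> B; y \<in> B; z \<in> B\<rbrakk> \<Longrightarrow> disj (disj x y) z = disj x (disj y z)"
    and "\<lbrakk>x \<in> B; y \<in> B\<rbrakk> \<Longrightarrow> conj x y = conj y x"
    and "\<lbrakk>x \<in> B; y \<in> B\<rbrakk> \<Longrightarrow> disj x y = disj y x"
    and "\<lbrakk>x \<in> B; y \<in> B; z \<in> B\<rbrakk> \<Longrightarrow> conj x (disj y z) = disj (conj x y) (conj x z)"
    and "\<lbrakk>x \<in> B; y \<in> B; z \<in> B\<rbrakk> \<Longrightarrow> disj x (conj y z) = conj (disj x y) (disj x z)"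
    and "x \<in> B \<Longrightarrow> conj x one = x"
    and "x \<in> B \<Longrightarrow> disj x zero = x"
    and "x \<in> B \<Longrightarrow> conj x (compl x) = zero"
    and "x \<in> B \<Longrightarrow> disj x (compl x) = one"


section \<open>Free algebras\<close>

datatype sidedness = Left_Handed | Right_Handed | Two_Sided

definition in_variety :: "sidedness \<Rightarrow> 'a skew_ba \<Rightarrow> bool" where
  "in_variety V S \<longleftrightarrow> skew_boolean_algebra S \<and>
     (case V of Left_Handed \<Rightarrow> left_handed S | Right_Handed \<Rightarrow> right_handed S | Two_Sided \<Rightarrow> True)"

definition skew_ba_hom :: "'a skew_ba \<Rightarrow> 'b skew_ba \<Rightarrow> ('a \<Rightarrow> 'b) set" where
  "skew_ba_hom A B = {h \<in> carrier A \<rightarrow> carrier B.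
     (\<forall>x\<in>carrier A. \<forall>y\<in>carrier A.
        h (x \<^bold>\<and>\<^bsub>A\<^esub> y) = h x \<^bold>\<and>\<^bsub>B\<^esub> h y \<and>
        h (x \<^bold>\<or>\<^bsub>A\<^esub> y) = h x \<^bold>\<or>\<^bsub>B\<^esub> h y \<and>
        h (x \<setminus>\<^bsub>A\<^esub> y) = h x \<setminus>\<^bsub>B\<^esub> h y) \<and>
     h \<^bold>0\<^bsub>A\<^esub> = \<^bold>0\<^bsub>B\<^esub>}"

text \<open>The universal property of \<open>S\<close> as the free algebra on \<open>X\<close>, for target algebras whose
  elements have type \<open>'b\<close>. Homomorphisms are functions on a whole type, hence unique only on
  the carrier.\<close>

definition universal_at :: "'b itself \<Rightarrow> sidedness \<Rightarrow> 'a skew_ba \<Rightarrow> 'a set \<Rightarrow> bool" where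
  "universal_at (_ :: 'b itself) V S X \<longleftrightarrow>
     (\<forall>(B :: 'b skew_ba) f. in_variety V B \<longrightarrow> f \<in> X \<rightarrow> carrier B \<longrightarrow>
        (\<exists>h\<in>skew_ba_hom S B. (\<forall>x\<in>X. h x = f x) \<and>
           (\<forall>h'\<in>skew_ba_hom S B. (\<forall>x\<in>X. h' x = f x) \<longrightarrow> (\<forall>s\<in>carrier S. h' s = h s))))"

datatype 'v skew_term =
    Var 'v
  | Zero
  | Meet "'v skew_term" "'v skew_term"
  | Join "'v skew_term" "'v skew_term"
  | Diff "'v skew_term" "'v skew_term"

text \<open>HOL cannot quantify over all types inside a formula, so the universal property is required
  for one type of targets only. Sets of terms over \<open>'a\<close> are enough: \<open>free_skew_ba_universal\<close>
  below recovers the universal property for targets of every type, and \<open>free_skew_ba_exists\<close>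
  shows that free algebras on sets of arbitrary size exist.\<close>

definition free_skew_ba :: "sidedness \<Rightarrow> 'a skew_ba \<Rightarrow> 'a set \<Rightarrow> bool" where
  "free_skew_ba V S X \<longleftrightarrow> in_variety V S \<and> X \<subseteq> carrier S \<and>
     universal_at TYPE('a skew_term set) V S X"


subsection \<open>The term model\<close>

inductive term_eq :: "sidedness \<Rightarrow> 'v skew_term \<Rightarrow> 'v skew_term \<Rightarrow> bool" for V where
  refl: "term_eq V t t"
| sym: "term_eq V s t \<Longrightarrow> term_eq V t s"
| trans: "term_eq V s t \<Longrightarrow> term_eq V t u \<Longrightarrow> term_eq V s u"
| meet_cong: "term_eq V s s' \<Longrightarrow> term_eq V t t' \<Longrightarrow> term_eq V (Meet s t) (Meet s' t')"
| join_cong: "term_eq V s s' \<Longrightarrow> term_eq V t t' \<Longrightarrow> term_eq V (Join s t) (Join s' t')"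
| diff_cong: "term_eq V s s' \<Longrightarrow> term_eq V t t' \<Longrightarrow> term_eq V (Diff s t) (Diff s' t')"
| meet_assoc: "term_eq V (Meet (Meet s t) u) (Meet s (Meet t u))"
| join_assoc: "term_eq V (Join (Join s t) u) (Join s (Join t u))"
| meet_absorb_left: "term_eq V (Meet s (Join s t)) s"
| meet_absorb_right: "term_eq V (Meet (Join t s) s) s"
| join_absorb_left: "term_eq V (Join s (Meet s t)) s"
| join_absorb_right: "term_eq V (Join (Meet t s) s) s"
| meet_join_distrib: "term_eq V (Meet s (Join t u)) (Join (Meet s t) (Meet s u))"
| join_meet_distrib: "term_eq V (Meet (Join s t) u) (Join (Meet s u) (Meet t u))"
| zero_meet: "term_eq V (Meet Zero s) Zero"
| meet_zero: "term_eq V (Meet s Zero) Zero"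
| zero_join: "term_eq V (Join Zero s) s"
| join_zero: "term_eq V (Join s Zero) s"
| diff_join: "term_eq V (Join (Meet (Meet s t) s) (Diff s t)) s"
| meet_diff: "term_eq V (Meet (Meet (Meet s t) s) (Diff s t)) Zero"
| diff_meet: "term_eq V (Meet (Diff s t) (Meet (Meet s t) s)) Zero"
| left_meet: "V = Left_Handed \<Longrightarrow> term_eq V (Meet (Meet s t) s) (Meet s t)"
| left_join: "V = Left_Handed \<Longrightarrow> term_eq V (Join (Join s t) s) (Join t s)"
| right_meet: "V = Right_Handed \<Longrightarrow> term_eq V (Meet (Meet s t) s) (Meet t s)"
| right_join: "V = Right_Handed \<Longrightarrow> term_eq V (Join (Join s t) s) (Join s t)"

definition term_class :: "sidedness \<Rightarrow> 'v skew_term \<Rightarrow> 'v skew_term set" where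
  "term_class V t = {s. term_eq V t s}"

definition term_rep :: "'v skew_term set \<Rightarrow> 'v skew_term" where
  "term_rep A = (SOME t. t \<in> A)"

definition term_model :: "sidedness \<Rightarrow> 'v set \<Rightarrow> 'v skew_term set skew_ba" where
  "term_model V X = \<lparr>carrier = term_class V ` {t. set_skew_term t \<subseteq> X},
     skew_meet = (\<lambda>A B. term_class V (Meet (term_rep A) (term_rep B))),
     skew_join = (\<lambda>A B. term_class V (Join (term_rep A) (term_rep B))),
     skew_diff = (\<lambda>A B. term_class V (Diff (term_rep A) (term_rep B))),
     skew_zero = term_class V Zero\<rparr>"

primrec term_eval :: "'b skew_ba \<Rightarrow> ('v \<Rightarrow> 'b) \<Rightarrow> 'v skew_term \<Rightarrow> 'b" where
  "term_eval B f (Var v) = f v"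
| "term_eval B f Zero = \<^bold>0\<^bsub>B\<^esub>"
| "term_eval B f (Meet s t) = term_eval B f s \<^bold>\<and>\<^bsub>B\<^esub> term_eval B f t"
| "term_eval B f (Join s t) = term_eval B f s \<^bold>\<or>\<^bsub>B\<^esub> term_eval B f t"
| "term_eval B f (Diff s t) = term_eval B f s \<setminus>\<^bsub>B\<^esub> term_eval B f t"

lemma term_class_eq_iff: "term_class V s = term_class V t \<longleftrightarrow> term_eq V s t"
  unfolding term_class_def by (blast intro: term_eq.refl term_eq.sym term_eq.trans)

lemma term_eq_rep: "term_eq V (term_rep (term_class V t)) t"
proof -
  have "term_rep (term_class V t) \<in> term_class V t"
    unfolding term_rep_def by (rule someI[of _ t]) (simp add: term_class_def term_eq.refl)
  then show ?thesis
    by (simp add: term_class_def term_eq.sym)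
qed

lemma term_model_simps:
  "carrier (term_model V X) = term_class V ` {t. set_skew_term t \<subseteq> X}"
  "skew_meet (term_model V X) (term_class V s) (term_class V t) = term_class V (Meet s t)"
  "skew_join (term_model V X) (term_class V s) (term_class V t) = term_class V (Join s t)"
  "skew_diff (term_model V X) (term_class V s) (term_class V t) = term_class V (Diff s t)"
  "skew_zero (term_model V X) = term_class V Zero"
  unfolding term_model_def
  by (simp_all add: term_class_eq_iff term_eq_rep term_eq.meet_cong term_eq.join_cong
      term_eq.diff_cong)

lemma term_class_ex:
  "A \<in> carrier (term_model V X) \<Longrightarrow> \<exists>t. A = term_class V t \<and> set_skew_term t \<subseteq> X"
  by (auto simp: term_model_simps(1))

lemma term_class_in: "set_skew_term t \<subseteq> X \<Longrightarrow> term_class V t \<in> carrier (term_model V X)"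
  by (simp add: term_model_simps(1))

lemma term_model_in_variety: "in_variety V (term_model V X)"
proof -
  note eqs = term_eq.meet_assoc term_eq.join_assoc term_eq.meet_absorb_left
    term_eq.meet_absorb_right term_eq.join_absorb_left term_eq.join_absorb_right
    term_eq.meet_join_distrib term_eq.join_meet_distrib term_eq.zero_meet term_eq.meet_zero
    term_eq.zero_join term_eq.join_zero term_eq.diff_join term_eq.meet_diff term_eq.diff_meet
  have "skew_boolean_algebra (term_model V X)"
    by unfold_locales
      (((drule term_class_ex)+, elim exE conjE)?,
        simp add: term_model_simps(2-) term_class_eq_iff eqs term_class_in)+
  moreover have "left_handed (term_model V X)" if "V = Left_Handed"
    unfolding left_handed_def
    by (intro ballI; drule term_class_ex, drule term_class_ex, elim exE conjE,
        simp add: term_model_simps(2-) term_class_eq_iff term_eq.left_meet term_eq.left_join that)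
  moreover have "right_handed (term_model V X)" if "V = Right_Handed"
    unfolding right_handed_def
    by (intro ballI; drule term_class_ex, drule term_class_ex, elim exE conjE,
        simp add: term_model_simps(2-) term_class_eq_iff term_eq.right_meet term_eq.right_join that)
  ultimately show ?thesis
    by (auto simp: in_variety_def split: sidedness.split)
qed

lemma term_eval_closed:
  assumes "in_variety V B" "\<And>v. v \<in> set_skew_term t \<Longrightarrow> f v \<in> carrier B"
  shows "term_eval B f t \<in> carrier B"
proof -
  interpret skew_boolean_algebra B using assms(1) by (simp add: in_variety_def)
  show ?thesis using assms(2)
    by (induction t) (simp_all add: meet_closed join_closed diff_closed zero_closed)
qed

lemma term_eval_sound:
  assumes B: "in_variety V B" and f: "\<And>v. f v \<in> carrier B" and "term_eq V s t"
  shows "term_eval B f s = term_eval B f t"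
proof -
  interpret skew_boolean_algebra B using B by (simp add: in_variety_def)
  have cl: "term_eval B f u \<in> carrier B" for u
    by (rule term_eval_closed[OF B f])
  have L: "V = Left_Handed \<Longrightarrow> left_handed B" and R: "V = Right_Handed \<Longrightarrow> right_handed B"
    using B by (auto simp: in_variety_def)
  show ?thesis using assms(3)
  proof (induction rule: term_eq.induct)
    case (left_meet s t) then show ?case using L[OF left_meet] cl by (simp add: left_handed_def)
  next
    case (left_join s t) then show ?case using L[OF left_join] cl by (simp add: left_handed_def)
  next
    case (right_meet s t) then show ?case using R[OF right_meet] cl by (simp add: right_handed_def)
  next
    case (right_join s t) then show ?case using R[OF right_join] cl by (simp add: right_handed_def)
  qed (simp_all only: term_eval.simps,
      (rule meet_assoc join_assoc meet_absorb_left meet_absorb_right join_absorb_left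
        join_absorb_right meet_join_distrib join_meet_distrib zero_meet meet_zero zero_join
        join_zero diff_join meet_diff diff_meet; rule cl)+)
qed

lemma skew_ba_homD:
  assumes "h \<in> skew_ba_hom A B"
  shows "x \<in> carrier A \<Longrightarrow> h x \<in> carrier B"
    and "\<lbrakk>x \<in> carrier A; y \<in> carrier A\<rbrakk> \<Longrightarrow> h (skew_meet A x y) = skew_meet B (h x) (h y)"
    and "\<lbrakk>x \<in> carrier A; y \<in> carrier A\<rbrakk> \<Longrightarrow> h (skew_join A x y) = skew_join B (h x) (h y)"
    and "\<lbrakk>x \<in> carrier A; y \<in> carrier A\<rbrakk> \<Longrightarrow> h (skew_diff A x y) = skew_diff B (h x) (h y)"
    and "h (skew_zero A) = skew_zero B"
  using assms by (simp_all add: skew_ba_hom_def Pi_iff)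

lemma skew_ba_homI:
  assumes "\<And>x. x \<in> carrier A \<Longrightarrow> h x \<in> carrier B"
    and "\<And>x y. \<lbrakk>x \<in> carrier A; y \<in> carrier A\<rbrakk> \<Longrightarrow> h (skew_meet A x y) = skew_meet B (h x) (h y)"
    and "\<And>x y. \<lbrakk>x \<in> carrier A; y \<in> carrier A\<rbrakk> \<Longrightarrow> h (skew_join A x y) = skew_join B (h x) (h y)"
    and "\<And>x y. \<lbrakk>x \<in> carrier A; y \<in> carrier A\<rbrakk> \<Longrightarrow> h (skew_diff A x y) = skew_diff B (h x) (h y)"
    and "h (skew_zero A) = skew_zero B"
  shows "h \<in> skew_ba_hom A B"
  using assms by (simp add: skew_ba_hom_def Pi_iff)

lemma term_model_hom_eval:
  assumes "h \<in> skew_ba_hom (term_model V X) B" "set_skew_term t \<subseteq> X"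
  shows "h (term_class V t) = term_eval B (\<lambda>x. h (term_class V (Var x))) t"
  using assms(2)
proof (induction t)
  case Zero
  show ?case
    using skew_ba_homD(5)[OF assms(1)] by (simp add: term_model_simps(5))
next
  case (Meet s t)
  then show ?case
    using skew_ba_homD(2)[OF assms(1), of "term_class V s" "term_class V t"]
    by (simp add: term_class_in term_model_simps(2))
next
  case (Join s t)
  then show ?case
    using skew_ba_homD(3)[OF assms(1), of "term_class V s" "term_class V t"]
    by (simp add: term_class_in term_model_simps(3))
next
  case (Diff s t)
  then show ?case
    using skew_ba_homD(4)[OF assms(1), of "term_class V s" "term_class V t"]
    by (simp add: term_class_in term_model_simps(4))
qed simp

lemma term_eval_cong:
  "(\<And>v. v \<in> set_skew_term t \<Longrightarrow> f v = g v) \<Longrightarrow> term_eval B f t = term_eval B g t"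
  by (induction t) auto

lemma term_model_hom_ext:
  assumes "h \<in> skew_ba_hom (term_model V X) B" "h' \<in> skew_ba_hom (term_model V X) B"
    and "\<And>x. x \<in> X \<Longrightarrow> h (term_class V (Var x)) = h' (term_class V (Var x))"
    and "A \<in> carrier (term_model V X)"
  shows "h A = h' A"
proof -
  obtain t where t: "A = term_class V t" "set_skew_term t \<subseteq> X"
    using term_class_ex[OF assms(4)] by blast
  show ?thesis
    unfolding t(1) term_model_hom_eval[OF assms(1) t(2)] term_model_hom_eval[OF assms(2) t(2)]
    by (rule term_eval_cong) (use assms(3) t(2) in blast)
qed

lemma term_model_hom_exists:
  assumes B: "in_variety V B" and f: "\<And>x. x \<in> X \<Longrightarrow> f x \<in> carrier B"
  obtains h where "h \<in> skew_ba_hom (term_model V X) B"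
    "\<And>x. x \<in> X \<Longrightarrow> h (term_class V (Var x)) = f x"
proof -
  interpret skew_boolean_algebra B using B by (simp add: in_variety_def)
  define g where "g x = (if x \<in> X then f x else skew_zero B)" for x
  have g: "g x \<in> carrier B" for x using f zero_closed by (simp add: g_def)
  define h where "h A = term_eval B g (term_rep A)" for A
  have h: "h (term_class V t) = term_eval B g t" for t
    unfolding h_def by (rule term_eval_sound[OF B g term_eq_rep])
  have "h \<in> skew_ba_hom (term_model V X) B"
    by (rule skew_ba_homI; (drule term_class_ex, drule term_class_ex, elim exE conjE |
        drule term_class_ex, elim exE conjE)?;
        simp add: term_model_simps(2-) h term_eval_closed[OF B g])
  moreover have "h (term_class V (Var x)) = f x" if "x \<in> X" for x
    using that by (simp add: h g_def)
  ultimately show ?thesis using that by blast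
qed

lemma skew_ba_hom_comp:
  assumes "g \<in> skew_ba_hom A B" "h \<in> skew_ba_hom B C"
  shows "h \<circ> g \<in> skew_ba_hom A C"
  by (rule skew_ba_homI) (simp_all add: skew_ba_homD[OF assms(1)] skew_ba_homD[OF assms(2)])


subsection \<open>Existence, and independence of the type of the target\<close>

definition pow_skew_ba :: "'v set skew_ba" where
  "pow_skew_ba = \<lparr>carrier = UNIV, skew_meet = (\<inter>), skew_join = (\<union>), skew_diff = (-),
     skew_zero = {}\<rparr>"

lemma pow_skew_ba_in_variety: "in_variety V pow_skew_ba"
proof -
  have "skew_boolean_algebra pow_skew_ba"
    by unfold_locales (auto simp: pow_skew_ba_def)
  moreover have "left_handed pow_skew_ba" "right_handed pow_skew_ba"
    by (auto simp: left_handed_def right_handed_def pow_skew_ba_def)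
  ultimately show ?thesis by (auto simp: in_variety_def split: sidedness.split)
qed

lemma inj_term_class_Var: "inj (\<lambda>x :: 'v. term_class V (Var x))"
proof (rule injI)
  fix x y :: 'v assume "term_class V (Var x) = term_class V (Var y)"
  then have "term_eq V (Var x) (Var y)" by (simp add: term_class_eq_iff)
  then have "term_eval pow_skew_ba (\<lambda>v. {v}) (Var x) = term_eval pow_skew_ba (\<lambda>v. {v}) (Var y)"
    by (intro term_eval_sound[OF pow_skew_ba_in_variety]) (simp_all add: pow_skew_ba_def)
  then show "x = y" by simp
qed

lemma term_model_universal:
  "universal_at TYPE('b) V (term_model V X) ((\<lambda>x. term_class V (Var x)) ` X)"
  unfolding universal_at_def
proof (intro allI impI)
  fix B :: "'b skew_ba" and f
  assume B: "in_variety V B" and f: "f \<in> (\<lambda>x. term_class V (Var x)) ` X \<rightarrow> carrier B"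
  have fX: "f (term_class V (Var x)) \<in> carrier B" if "x \<in> X" for x
    by (rule Pi_mem[OF f imageI[OF that]])
  obtain h where h: "h \<in> skew_ba_hom (term_model V X) B"
    "\<And>x. x \<in> X \<Longrightarrow> h (term_class V (Var x)) = f (term_class V (Var x))"
    by (rule term_model_hom_exists[of V B X "\<lambda>x. f (term_class V (Var x))", OF B fX])
      (assumption, rule that)
  show "\<exists>h\<in>skew_ba_hom (term_model V X) B. (\<forall>x\<in>(\<lambda>x. term_class V (Var x)) ` X. h x = f x) \<and>
      (\<forall>h'\<in>skew_ba_hom (term_model V X) B. (\<forall>x\<in>(\<lambda>x. term_class V (Var x)) ` X. h' x = f x) \<longrightarrow>
        (\<forall>s\<in>carrier (term_model V X). h' s = h s))"
  proof (intro bexI[OF _ h(1)] conjI ballI impI)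
    fix h' s
    assume h': "h' \<in> skew_ba_hom (term_model V X) B"
      "\<forall>x\<in>(\<lambda>x. term_class V (Var x)) ` X. h' x = f x" and s: "s \<in> carrier (term_model V X)"
    show "h' s = h s"
      by (rule term_model_hom_ext[OF h'(1) h(1) _ s]) (simp add: h h'(2))
  qed (use h(2) in auto)
qed

theorem free_skew_ba_exists:
  fixes X :: "'v set"
  shows "\<exists>(S :: 'v skew_term set skew_ba) i. inj_on i X \<and> free_skew_ba V S (i ` X)"
proof -
  have "(\<lambda>x. term_class V (Var x)) ` X \<subseteq> carrier (term_model V X)"
    by (rule image_subsetI) (simp add: term_class_in)
  then have "free_skew_ba V (term_model V X) ((\<lambda>x. term_class V (Var x)) ` X)"
    by (simp add: free_skew_ba_def term_model_in_variety term_model_universal)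
  then show ?thesis using inj_on_subset[OF inj_term_class_Var subset_UNIV] by blast
qed

definition transport :: "('a \<Rightarrow> 'b) \<Rightarrow> 'a skew_ba \<Rightarrow> 'b skew_ba" where
  "transport e S = \<lparr>carrier = e ` carrier S,
     skew_meet = (\<lambda>x y. e (skew_meet S (inv e x) (inv e y))),
     skew_join = (\<lambda>x y. e (skew_join S (inv e x) (inv e y))),
     skew_diff = (\<lambda>x y. e (skew_diff S (inv e x) (inv e y))),
     skew_zero = e (skew_zero S)\<rparr>"

lemma transport_in_variety:
  assumes "inj e" "in_variety V S"
  shows "in_variety V (transport e S)"
proof -
  interpret skew_boolean_algebra S using assms(2) by (simp add: in_variety_def)
  have "skew_boolean_algebra (transport e S)"
    by (unfold_locales,
        auto simp: transport_def inv_f_f[OF assms(1)] meet_closed join_closed diff_closed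
          zero_closed meet_absorb_left meet_absorb_right join_absorb_left join_absorb_right
          meet_join_distrib join_meet_distrib zero_meet meet_zero zero_join join_zero diff_join
          meet_diff diff_meet)
      (simp_all add: meet_assoc join_assoc)
  moreover have "left_handed (transport e S)" if "left_handed S"
    using that by (auto simp: left_handed_def transport_def inv_f_f[OF assms(1)])
  moreover have "right_handed (transport e S)" if "right_handed S"
    using that by (auto simp: right_handed_def transport_def inv_f_f[OF assms(1)])
  ultimately show ?thesis
    using assms(2) by (auto simp: in_variety_def split: sidedness.splits)
qed

lemma transport_hom: "inj e \<Longrightarrow> e \<in> skew_ba_hom S (transport e S)"
  by (rule skew_ba_homI) (simp_all add: transport_def)

lemma universal_atE:
  fixes B :: "'b skew_ba"
  assumes "universal_at TYPE('b) V S X" "in_variety V B" "f \<in> X \<rightarrow> carrier B"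
  obtains h where "h \<in> skew_ba_hom S B" "\<forall>x\<in>X. h x = f x"
    "\<forall>h'\<in>skew_ba_hom S B. (\<forall>x\<in>X. h' x = f x) \<longrightarrow> (\<forall>s\<in>carrier S. h' s = h s)"
proof -
  from assms(1)[unfolded universal_at_def, rule_format, OF assms(2,3)]
  show ?thesis by (elim bexE conjE) (rule that)
qed

theorem free_skew_ba_universal:
  fixes S :: "'a skew_ba"
  assumes "free_skew_ba V S X"
  shows "universal_at TYPE('b) V S X"
proof -
  have S: "in_variety V S" and X: "X \<subseteq> carrier S"
    and U: "universal_at TYPE('a skew_term set) V S X"
    using assms by (auto simp: free_skew_ba_def)
  let ?T = "term_model V X" and ?i = "\<lambda>x. term_class V (Var x)" and ?e = "\<lambda>x :: 'a. {Var x}"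
  have iT: "?i \<in> X \<rightarrow> carrier ?T" by (simp add: term_class_in)
  obtain h where h: "h \<in> skew_ba_hom S ?T" "\<forall>x\<in>X. h x = ?i x"
    by (rule universal_atE[OF U term_model_in_variety iT])
  obtain g where g: "g \<in> skew_ba_hom ?T S" "\<And>x. x \<in> X \<Longrightarrow> g (?i x) = x"
    by (rule term_model_hom_exists[of V S X "\<lambda>x. x", OF S subsetD[OF X]]) (assumption, rule that)
  have e: "inj ?e" by (auto intro: injI)
  have gh: "g (h s) = s" if s: "s \<in> carrier S" for s
  proof -
    have "?e \<in> X \<rightarrow> carrier (transport ?e S)"
      by (rule Pi_I) (simp add: transport_def subsetD[OF X])
    then obtain k where k: "\<forall>h'\<in>skew_ba_hom S (transport ?e S).
        (\<forall>x\<in>X. h' x = ?e x) \<longrightarrow> (\<forall>s\<in>carrier S. h' s = k s)"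
      by (rule universal_atE[OF U transport_in_variety[OF e S]])
    have "?e \<circ> (g \<circ> h) \<in> skew_ba_hom S (transport ?e S)"
      by (rule skew_ba_hom_comp[OF skew_ba_hom_comp[OF h(1) g(1)] transport_hom[OF e]])
    then have "(?e \<circ> (g \<circ> h)) s = k s"
      by (rule k[rule_format]) (simp_all add: h(2) g(2) s)
    moreover have "?e s = k s"
      by (rule k[rule_format, OF transport_hom[OF e]]) (simp_all add: s)
    ultimately have "(?e \<circ> (g \<circ> h)) s = ?e s" by (simp only:)
    then show ?thesis by simp
  qed
  show ?thesis unfolding universal_at_def
  proof (intro allI impI)
    fix B :: "'b skew_ba" and f assume B: "in_variety V B" and f: "f \<in> X \<rightarrow> carrier B"
    obtain k where k: "k \<in> skew_ba_hom ?T B" "\<And>x. x \<in> X \<Longrightarrow> k (?i x) = f x"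
        by (rule term_model_hom_exists[of V B X f, OF B Pi_mem[OF f]]) (assumption, rule that)
    have "k \<circ> h \<in> skew_ba_hom S B" by (rule skew_ba_hom_comp[OF h(1) k(1)])
    moreover have "\<forall>x\<in>X. (k \<circ> h) x = f x" using h(2) k(2) by simp
    moreover have "h' s = (k \<circ> h) s"
      if h': "h' \<in> skew_ba_hom S B" "\<forall>x\<in>X. h' x = f x" and s: "s \<in> carrier S" for h' s
    proof -
      have "(h' \<circ> g) (h s) = k (h s)"
      proof (rule term_model_hom_ext[OF skew_ba_hom_comp[OF g(1) h'(1)] k(1)])
        show "h s \<in> carrier ?T" using h(1) s by (rule skew_ba_homD(1))
      qed (use g(2) h'(2) k(2) in simp)
      then show ?thesis using gh[OF s] by simp
    qed
    ultimately show "\<exists>h\<in>skew_ba_hom S B. (\<forall>x\<in>X. h x = f x) \<and>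
        (\<forall>h'\<in>skew_ba_hom S B. (\<forall>x\<in>X. h' x = f x) \<longrightarrow> (\<forall>s\<in>carrier S. h' s = h s))"
      by blast
  qed
qed

end

theory Submission
  imports Defs
begin

text \<open>
  In a left-handed primitive algebra the meet of two nonzero elements is the first of them, in a
  right-handed one the second; either way distinct nonzero elements never commute. The free
  one-sided algebra on a finite set \<open>X\<close> of size \<open>n\<close> is the product, over all nonempty \<open>Y \<subseteq> X\<close>, of
  the primitive algebras whose nonzero elements are the members of \<open>Y\<close>; in the two-sided case the
  nonzero elements form the rectangular band on \<open>Y \<times> Y\<close> instead. A central element must vanish on every
  noncommutative factor, and what remains are the \<open>n\<close> factors belonging to singletons \<open>Y\<close>, each
  of which is a two-element algebra. This explains the number \<open>2 ^ n\<close>.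

  The proof keeps this idea and avoids the decomposition. Let \<open>c\<close> be central. A homomorphism to a
  primitive algebra that separates two generators, both with nonzero image, sends \<open>c\<close> to zero
  (\<open>center_hom_primitive_None\<close>). On the other hand, whether a homomorphism to a primitive algebra
  kills an element depends only on which generators it kills, and every nonzero element survives
  for a suitable choice of the killed generators occurring in it (\<open>nonzero_term_zero_pattern\<close>).
  The values of the surviving generators, and of the generators that do not occur, remain free to
  choose. If \<open>X\<close> is infinite, two generators that do not occur in \<open>c\<close> can be separated, so
  \<open>c\<close> is zero. If \<open>X\<close> is finite, the same argument applied to \<open>c \<^bold>\<and> x \<^bold>\<and> y\<close> shows that it is zero
  for distinct generators \<open>x\<close> and \<open>y\<close>.

  For finite \<open>X\<close>, let \<open>a x\<close> be what is left of the generator \<open>x\<close> after all other generators have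
  been removed from it. Every element of the algebra lies above \<open>a x\<close> or is orthogonal to it,
  because this holds for the generators (\<open>generators_decide\<close>); hence \<open>a x\<close> is central.
  Since \<open>c \<^bold>\<and> x\<close> is orthogonal to the other generators, it equals \<open>c \<^bold>\<and> a x\<close>, so \<open>c\<close> is determined
  by the set of all \<open>x\<close> with \<open>a x\<close> below \<open>c\<close>, and joins of the \<open>a x\<close> realise every subset of \<open>X\<close>.
\<close>

section \<open>Meets, zero and the natural order\<close>

context skew_boolean_algebra
begin

lemma meet_idem: "x \<in> carrier S \<Longrightarrow> x \<^bold>\<and> x = x"
  by (metis join_absorb_left meet_absorb_left meet_closed)

lemma join_idem: "x \<in> carrier S \<Longrightarrow> x \<^bold>\<or> x = x"
  by (metis join_absorb_left join_closed meet_absorb_left)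

lemma meet_left_idem:
  "\<lbrakk>x \<in> carrier S; y \<in> carrier S\<rbrakk> \<Longrightarrow> x \<^bold>\<and> (x \<^bold>\<and> y) = x \<^bold>\<and> y"
  by (metis meet_assoc meet_idem)

lemmas closed = meet_closed join_closed diff_closed zero_closed

lemma meet_zero_commute:
  assumes "x \<in> carrier S" "y \<in> carrier S" "x \<^bold>\<and> y = \<^bold>0"
  shows "y \<^bold>\<and> x = \<^bold>0"
proof -
  have "y \<^bold>\<and> x = (y \<^bold>\<and> x) \<^bold>\<and> (y \<^bold>\<and> x)" by (simp add: assms closed meet_idem)
  also have "\<dots> = y \<^bold>\<and> ((x \<^bold>\<and> y) \<^bold>\<and> x)" by (simp add: assms(1,2) closed meet_assoc)
  also have "\<dots> = \<^bold>0" by (simp add: assms zero_meet meet_zero)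
  finally show ?thesis .
qed

text \<open>Orthogonality survives insertion of any factor: by idempotence the product equals its own
  square, in which \<open>y\<close> and \<open>x\<close> become neighbours.\<close>

lemma meet_zero_sandwich:
  assumes "x \<in> carrier S" "y \<in> carrier S" "z \<in> carrier S" "x \<^bold>\<and> y = \<^bold>0"
  shows "x \<^bold>\<and> (z \<^bold>\<and> y) = \<^bold>0"
proof -
  let ?u = "x \<^bold>\<and> (z \<^bold>\<and> y)"
  have "?u = ?u \<^bold>\<and> ?u" by (simp add: assms closed meet_idem)
  also have "\<dots> = x \<^bold>\<and> (z \<^bold>\<and> ((y \<^bold>\<and> x) \<^bold>\<and> (z \<^bold>\<and> y)))"
    by (simp add: assms(1-3) closed meet_assoc)
  also have "\<dots> = \<^bold>0"
    by (simp add: assms closed meet_zero_commute[OF assms(1,2,4)] zero_meet meet_zero)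
  finally show ?thesis .
qed

lemma diff_le:
  assumes "x \<in> carrier S" "y \<in> carrier S"
  shows "x \<^bold>\<and> (x \<setminus> y) = x \<setminus> y" "(x \<setminus> y) \<^bold>\<and> x = x \<setminus> y"
proof -
  let ?m = "x \<^bold>\<and> y \<^bold>\<and> x"
  have m: "?m \<in> carrier S" "x \<setminus> y \<in> carrier S" using assms closed by simp_all
  have "x \<^bold>\<and> (x \<setminus> y) = (?m \<^bold>\<or> (x \<setminus> y)) \<^bold>\<and> (x \<setminus> y)" by (simp only: diff_join[OF assms])
  also have "\<dots> = x \<setminus> y"
    by (rule meet_absorb_right) (use m in auto)
  finally show "x \<^bold>\<and> (x \<setminus> y) = x \<setminus> y" .
  have "(x \<setminus> y) \<^bold>\<and> x = (x \<setminus> y) \<^bold>\<and> (?m \<^bold>\<or> (x \<setminus> y))" by (simp only: diff_join[OF assms])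
  also have "\<dots> = ((x \<setminus> y) \<^bold>\<and> ?m) \<^bold>\<or> ((x \<setminus> y) \<^bold>\<and> (x \<setminus> y))"
    by (rule meet_join_distrib) (use m in auto)
  also have "\<dots> = x \<setminus> y" by (simp only: diff_meet[OF assms] meet_idem[OF m(2)] zero_join[OF m(2)])
  finally show "(x \<setminus> y) \<^bold>\<and> x = x \<setminus> y" .
qed

lemma diff_meet_right:
  assumes "x \<in> carrier S" "y \<in> carrier S"
  shows "(x \<setminus> y) \<^bold>\<and> y = \<^bold>0"
proof -
  let ?d = "x \<setminus> y"
  have d: "?d \<in> carrier S" using assms closed by simp
  have "?d \<^bold>\<and> y = (?d \<^bold>\<and> y) \<^bold>\<and> (?d \<^bold>\<and> y)" by (simp add: assms closed meet_idem)
  also have "\<dots> = ((?d \<^bold>\<and> x) \<^bold>\<and> y) \<^bold>\<and> ((x \<^bold>\<and> ?d) \<^bold>\<and> y)" by (simp add: diff_le assms)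
  also have "\<dots> = (?d \<^bold>\<and> (x \<^bold>\<and> y \<^bold>\<and> x)) \<^bold>\<and> (?d \<^bold>\<and> y)" by (simp add: assms closed meet_assoc)
  also have "\<dots> = \<^bold>0" by (simp only: diff_meet[OF assms] zero_meet closed assms d)
  finally show ?thesis .
qed

lemma diff_zero: "x \<in> carrier S \<Longrightarrow> x \<setminus> \<^bold>0 = x"
  using diff_join[of x "\<^bold>0"] by (simp add: closed meet_zero zero_meet zero_join)

text \<open>The difference \<open>x \<setminus> y\<close> captures all of the part of \<open>x\<close> that is orthogonal to \<open>y\<close>.\<close>

lemma meet_diff_maximal:
  assumes "x \<in> carrier S" "y \<in> carrier S" "z \<in> carrier S" "z \<^bold>\<and> y = \<^bold>0"
  shows "z \<^bold>\<and> (x \<setminus> y) = z \<^bold>\<and> x"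
proof -
  have "z \<^bold>\<and> (x \<^bold>\<and> y \<^bold>\<and> x) = (z \<^bold>\<and> (x \<^bold>\<and> y)) \<^bold>\<and> x"
    by (simp add: assms(1-3) closed meet_assoc)
  then have "z \<^bold>\<and> (x \<^bold>\<and> y \<^bold>\<and> x) = \<^bold>0"
    by (simp add: meet_zero_sandwich assms zero_meet)
  then show ?thesis
    using meet_join_distrib[of z "x \<^bold>\<and> y \<^bold>\<and> x" "x \<setminus> y"]
    by (simp add: assms closed diff_join zero_join)
qed

text \<open>The identity \<open>a \<^bold>\<and> v \<^bold>\<and> a = a\<close> says that \<open>a\<close> lies below \<open>v\<close> modulo Green's relation \<open>\<D>\<close>. In any
  band such \<open>v\<close> are closed under products: squaring the factor \<open>w \<^bold>\<and> a \<^bold>\<and> v\<close> in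
  \<open>a \<^bold>\<and> w \<^bold>\<and> a \<^bold>\<and> v \<^bold>\<and> a\<close> brings \<open>v\<close> and \<open>w\<close> together.\<close>

lemma meet_sandwich_filter:
  assumes c: "a \<in> carrier S" "v \<in> carrier S" "w \<in> carrier S"
    and v: "a \<^bold>\<and> v \<^bold>\<and> a = a" and w: "a \<^bold>\<and> w \<^bold>\<and> a = a"
  shows "a \<^bold>\<and> (v \<^bold>\<and> w) \<^bold>\<and> a = a"
proof -
  let ?u = "w \<^bold>\<and> (a \<^bold>\<and> v)"
  have "a = (a \<^bold>\<and> w \<^bold>\<and> a) \<^bold>\<and> (a \<^bold>\<and> v \<^bold>\<and> a)" by (simp add: c v w meet_idem)
  also have "\<dots> = a \<^bold>\<and> ?u \<^bold>\<and> a"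
    by (simp add: c closed meet_assoc meet_left_idem)
  also have "\<dots> = a \<^bold>\<and> (?u \<^bold>\<and> ?u) \<^bold>\<and> a" by (simp add: c closed meet_idem)
  also have "\<dots> = (a \<^bold>\<and> w \<^bold>\<and> a) \<^bold>\<and> (v \<^bold>\<and> w) \<^bold>\<and> (a \<^bold>\<and> v \<^bold>\<and> a)"
    by (simp add: c closed meet_assoc)
  also have "\<dots> = a \<^bold>\<and> (v \<^bold>\<and> w) \<^bold>\<and> a" by (simp only: v w)
  finally show ?thesis by simp
qed

lemma sandwich_zero_iff:
  assumes "a \<in> carrier S" "v \<in> carrier S"
  shows "a \<^bold>\<and> v \<^bold>\<and> a = \<^bold>0 \<longleftrightarrow> a \<^bold>\<and> v = \<^bold>0"
proof
  assume "a \<^bold>\<and> v \<^bold>\<and> a = \<^bold>0"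
  then have "(a \<^bold>\<and> v) \<^bold>\<and> (a \<^bold>\<and> v) = \<^bold>0"
    using assms meet_assoc[of "a \<^bold>\<and> v" a v] by (simp add: closed zero_meet)
  then show "a \<^bold>\<and> v = \<^bold>0" using assms by (simp add: meet_idem closed)
qed (simp add: assms zero_meet)

lemma sandwich_diff_one:
  assumes c: "a \<in> carrier S" "v \<in> carrier S" "w \<in> carrier S"
    and v: "a \<^bold>\<and> v \<^bold>\<and> a = a" and w: "a \<^bold>\<and> w \<^bold>\<and> a = \<^bold>0"
  shows "a \<^bold>\<and> (v \<setminus> w) \<^bold>\<and> a = a"
  using meet_diff_maximal[of v w a] c v w by (simp add: sandwich_zero_iff)

lemma sandwich_diff_zero:
  assumes c: "a \<in> carrier S" "v \<in> carrier S" "w \<in> carrier S"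
    and vw: "a \<^bold>\<and> v \<^bold>\<and> a = \<^bold>0 \<or> a \<^bold>\<and> w \<^bold>\<and> a = a"
  shows "a \<^bold>\<and> (v \<setminus> w) \<^bold>\<and> a = \<^bold>0"
  using vw
proof
  assume "a \<^bold>\<and> v \<^bold>\<and> a = \<^bold>0"
  then have "(a \<^bold>\<and> v) \<^bold>\<and> (v \<setminus> w) = \<^bold>0"
    using c by (simp add: sandwich_zero_iff closed zero_meet)
  then have "a \<^bold>\<and> (v \<setminus> w) = \<^bold>0"
    using c by (simp add: closed meet_assoc diff_le)
  then show ?thesis using c by (simp add: zero_meet)
next
  assume w: "a \<^bold>\<and> w \<^bold>\<and> a = a"
  have "(v \<setminus> w) \<^bold>\<and> (a \<^bold>\<and> w) = \<^bold>0"
    using c by (intro meet_zero_sandwich diff_meet_right) (simp_all add: closed)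
  then have "a \<^bold>\<and> (((v \<setminus> w) \<^bold>\<and> (a \<^bold>\<and> w)) \<^bold>\<and> a) = \<^bold>0"
    using c by (simp add: zero_meet meet_zero)
  then have "a \<^bold>\<and> (v \<setminus> w) \<^bold>\<and> (a \<^bold>\<and> w \<^bold>\<and> a) = \<^bold>0"
    using c by (simp add: closed meet_assoc)
  then show ?thesis by (simp only: w)
qed

lemma sandwich_join:
  assumes "a \<in> carrier S" "v \<in> carrier S" "w \<in> carrier S"
  shows "a \<^bold>\<and> (v \<^bold>\<or> w) \<^bold>\<and> a = (a \<^bold>\<and> v \<^bold>\<and> a) \<^bold>\<or> (a \<^bold>\<and> w \<^bold>\<and> a)"
  using assms by (simp add: meet_join_distrib join_meet_distrib closed)

text \<open>Finitely many elements \<open>x\<close> can be decided in turn: whenever \<open>a \<^bold>\<and> x \<^bold>\<and> a\<close> is nonzero, it replaces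
  \<open>a\<close>, and decisions already taken persist when passing to a smaller element. The result plays
  the part that an atom or a prime filter plays for a Boolean algebra.\<close>

lemma exists_deciding_element:
  assumes "finite F" "F \<subseteq> carrier S" "s \<in> carrier S" "s \<noteq> \<^bold>0"
  shows "\<exists>a\<in>carrier S. a \<noteq> \<^bold>0 \<and> a \<^bold>\<and> s = a \<and>
    (\<forall>x\<in>F. a \<^bold>\<and> x \<^bold>\<and> a = \<^bold>0 \<or> a \<^bold>\<and> x \<^bold>\<and> a = a)"
  using assms(1,2)
proof (induction F rule: finite_induct)
  case empty
  then show ?case using assms(3,4) meet_idem by blast
next
  case (insert y F)
  then obtain a where a: "a \<in> carrier S" "a \<noteq> \<^bold>0" "a \<^bold>\<and> s = a"
    and dec: "\<And>x. x \<in> F \<Longrightarrow> a \<^bold>\<and> x \<^bold>\<and> a = \<^bold>0 \<or> a \<^bold>\<and> x \<^bold>\<and> a = a" by auto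
  have y: "y \<in> carrier S" using insert.prems by simp
  show ?case
  proof (cases "a \<^bold>\<and> y \<^bold>\<and> a = \<^bold>0")
    case True
    then show ?thesis using a dec by blast
  next
    case False
    let ?b = "a \<^bold>\<and> y \<^bold>\<and> a"
    have b: "?b \<in> carrier S" using a y closed by simp
    have ba: "?b \<^bold>\<and> a = ?b" "a \<^bold>\<and> ?b = ?b"
      using a y by (simp_all add: closed meet_assoc meet_idem meet_left_idem)
    have "?b \<^bold>\<and> s = ?b" using a y assms(3) by (simp add: closed meet_assoc)
    moreover have "?b \<^bold>\<and> x \<^bold>\<and> ?b = \<^bold>0 \<or> ?b \<^bold>\<and> x \<^bold>\<and> ?b = ?b" if x: "x \<in> F" for x
    proof -
      have xc: "x \<in> carrier S" using x insert.prems by auto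
      have "?b \<^bold>\<and> x \<^bold>\<and> ?b = (?b \<^bold>\<and> a) \<^bold>\<and> x \<^bold>\<and> (a \<^bold>\<and> ?b)" by (simp only: ba)
      also have "\<dots> = ?b \<^bold>\<and> (a \<^bold>\<and> x \<^bold>\<and> a) \<^bold>\<and> ?b"
        using meet_assoc meet_closed a(1) b xc by simp
      finally show ?thesis
        using dec[OF x] ba meet_idem[OF b] zero_meet[OF b] meet_zero[OF b] by auto
    qed
    moreover have "?b \<^bold>\<and> y \<^bold>\<and> ?b = ?b"
    proof -
      have "?b \<^bold>\<and> y \<^bold>\<and> ?b = ((a \<^bold>\<and> y) \<^bold>\<and> (a \<^bold>\<and> y) \<^bold>\<and> (a \<^bold>\<and> y)) \<^bold>\<and> a"
        using a(1) y by (simp add: closed meet_assoc)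
      also have "\<dots> = ?b" using a(1) y meet_idem[OF meet_closed[OF a(1) y]] by simp
      finally show ?thesis .
    qed
    ultimately show ?thesis using False b by blast
  qed
qed


section \<open>The center of a skew Boolean algebra\<close>

text \<open>Distributivity allows \<open>(x \<^bold>\<or> y) \<^bold>\<and> (y \<^bold>\<or> x)\<close> to be expanded from either side; one expansion
  gives \<open>y \<^bold>\<or> x\<close> and the other \<open>x \<^bold>\<or> y\<close>. Consequently only meets matter for the center.\<close>

lemma meet_commute_imp_join_commute:
  assumes "x \<in> carrier S" "y \<in> carrier S" "x \<^bold>\<and> y = y \<^bold>\<and> x"
  shows "x \<^bold>\<or> y = y \<^bold>\<or> x"
proof -
  have "(x \<^bold>\<or> y) \<^bold>\<and> (y \<^bold>\<or> x) = ((x \<^bold>\<or> y) \<^bold>\<and> y) \<^bold>\<or> ((x \<^bold>\<or> y) \<^bold>\<and> x)"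
    using assms by (simp add: meet_join_distrib closed)
  also have "(x \<^bold>\<or> y) \<^bold>\<and> y = y" using assms(2,1) by (rule meet_absorb_right)
  also have "(x \<^bold>\<or> y) \<^bold>\<and> x = x"
    using assms join_meet_distrib[of x y x] join_absorb_left[of x y] by (simp add: meet_idem)
  finally have 1: "(x \<^bold>\<or> y) \<^bold>\<and> (y \<^bold>\<or> x) = y \<^bold>\<or> x" .
  have "(x \<^bold>\<or> y) \<^bold>\<and> (y \<^bold>\<or> x) = (x \<^bold>\<and> (y \<^bold>\<or> x)) \<^bold>\<or> (y \<^bold>\<and> (y \<^bold>\<or> x))"
    using assms by (simp add: join_meet_distrib closed)
  also have "y \<^bold>\<and> (y \<^bold>\<or> x) = y" using assms(2,1) by (rule meet_absorb_left)
  also have "x \<^bold>\<and> (y \<^bold>\<or> x) = x"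
    using assms meet_join_distrib[of x y x] join_absorb_right[of x y] by (simp add: meet_idem)
  finally show ?thesis using 1 by simp
qed

lemma center_iff:
  "c \<in> center S \<longleftrightarrow> c \<in> carrier S \<and> (\<forall>x\<in>carrier S. c \<^bold>\<and> x = x \<^bold>\<and> c)"
  using meet_commute_imp_join_commute by (auto simp: center_def)

lemma center_carrier: "c \<in> center S \<Longrightarrow> c \<in> carrier S"
  by (simp add: center_iff)

lemma center_meet_commute: "\<lbrakk>c \<in> center S; x \<in> carrier S\<rbrakk> \<Longrightarrow> c \<^bold>\<and> x = x \<^bold>\<and> c"
  by (simp add: center_iff)

lemma center_join_commute: "\<lbrakk>c \<in> center S; x \<in> carrier S\<rbrakk> \<Longrightarrow> c \<^bold>\<or> x = x \<^bold>\<or> c"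
  by (simp add: center_def)

lemma zero_center: "\<^bold>0 \<in> center S"
  by (simp add: center_iff zero_closed zero_meet meet_zero)

lemma meet_center: "\<lbrakk>c \<in> center S; d \<in> center S\<rbrakk> \<Longrightarrow> c \<^bold>\<and> d \<in> center S"
  unfolding center_iff by (metis meet_assoc meet_closed)

lemma join_center: "\<lbrakk>c \<in> center S; d \<in> center S\<rbrakk> \<Longrightarrow> c \<^bold>\<or> d \<in> center S"
  unfolding center_iff by (simp add: join_closed join_meet_distrib meet_join_distrib)

text \<open>Centrality of \<open>e\<close> and \<open>c\<close> gives \<open>d \<^bold>\<and> s = d \<^bold>\<and> s \<^bold>\<and> d = s \<^bold>\<and> d\<close> for \<open>d = e \<setminus> c\<close>: the part of
  \<open>s\<close> that lies in \<open>e\<close> splits into one in \<open>c\<close>, which \<open>d\<close> annihilates, and one in \<open>d\<close>.\<close>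

lemma diff_center:
  assumes e: "e \<in> center S" and c: "c \<in> center S"
  shows "e \<setminus> c \<in> center S"
  unfolding center_iff
proof (intro conjI ballI)
  have cl: "e \<in> carrier S" "c \<in> carrier S" using e c by (simp_all add: center_carrier)
  then show d: "e \<setminus> c \<in> carrier S" by (simp add: closed)
  let ?d = "e \<setminus> c"
  fix s assume s: "s \<in> carrier S"
  have dc: "?d \<^bold>\<and> c = \<^bold>0" using cl by (rule diff_meet_right)
  have cd: "c \<^bold>\<and> ?d = \<^bold>0" using cl(2) d dc by (metis meet_zero_commute)
  have "?d \<^bold>\<and> s = ?d \<^bold>\<and> (e \<^bold>\<and> s)" using cl d s diff_le(2)[OF cl] by (simp flip: meet_assoc)
  also have "\<dots> = ?d \<^bold>\<and> (s \<^bold>\<and> e)" by (simp only: center_meet_commute[OF e s])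
  also have "\<dots> = (?d \<^bold>\<and> s) \<^bold>\<and> e" using cl d s by (simp add: meet_assoc)
  also have "\<dots> = (?d \<^bold>\<and> s) \<^bold>\<and> ?d"
    using cl d s meet_zero_sandwich[OF d cl(2) s dc]
    by (intro meet_diff_maximal[symmetric]) (simp_all add: closed meet_assoc)
  also have "\<dots> = s \<^bold>\<and> ?d"
  proof -
    have "s \<^bold>\<and> ?d = s \<^bold>\<and> (e \<^bold>\<and> ?d)" by (simp only: diff_le(1)[OF cl])
    also have "\<dots> = (s \<^bold>\<and> e) \<^bold>\<and> ?d" using cl d s by (simp add: meet_assoc)
    also have "\<dots> = (e \<^bold>\<and> s) \<^bold>\<and> ?d" by (simp only: center_meet_commute[OF e s])
    also have "\<dots> = (((e \<^bold>\<and> c \<^bold>\<and> e) \<^bold>\<or> ?d) \<^bold>\<and> s) \<^bold>\<and> ?d" by (simp only: diff_join[OF cl])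
    also have "\<dots> = (((e \<^bold>\<and> c \<^bold>\<and> e) \<^bold>\<and> s) \<^bold>\<and> ?d) \<^bold>\<or> ((?d \<^bold>\<and> s) \<^bold>\<and> ?d)"
      using cl d s by (simp add: join_meet_distrib closed)
    also have "((e \<^bold>\<and> c \<^bold>\<and> e) \<^bold>\<and> s) \<^bold>\<and> ?d = (e \<^bold>\<and> e \<^bold>\<and> s) \<^bold>\<and> (c \<^bold>\<and> ?d)"
      using cl d s center_meet_commute[OF c] by (simp add: closed meet_assoc)
    also have "\<dots> = \<^bold>0" using cl d s by (simp add: cd closed meet_zero)
    finally show ?thesis using d s by (simp add: closed zero_join)
  qed
  finally show "?d \<^bold>\<and> s = s \<^bold>\<and> ?d" .
qed

lemma center_join_meet_distrib:
  assumes x: "x \<in> center S" and y: "y \<in> center S" and z: "z \<in> center S"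
  shows "x \<^bold>\<or> (y \<^bold>\<and> z) = (x \<^bold>\<or> y) \<^bold>\<and> (x \<^bold>\<or> z)"
proof -
  have cl: "x \<in> carrier S" "y \<in> carrier S" "z \<in> carrier S"
    using x y z by (simp_all add: center_carrier)
  have "(x \<^bold>\<or> y) \<^bold>\<and> (x \<^bold>\<or> z) = ((x \<^bold>\<or> y) \<^bold>\<and> x) \<^bold>\<or> ((x \<^bold>\<or> y) \<^bold>\<and> z)"
    using cl by (simp add: meet_join_distrib closed)
  also have "(x \<^bold>\<or> y) \<^bold>\<and> x = x"
    using cl meet_absorb_right[of x y] center_join_commute[OF x cl(2)] by simp
  also have "x \<^bold>\<or> ((x \<^bold>\<or> y) \<^bold>\<and> z) = (x \<^bold>\<or> (x \<^bold>\<and> z)) \<^bold>\<or> (y \<^bold>\<and> z)"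
    using cl by (simp add: join_meet_distrib closed join_assoc)
  finally show ?thesis using cl by (simp add: join_absorb_left)
qed

lemma center_boolean_algebra:
  assumes e: "e \<in> center S" and top: "\<And>c. c \<in> center S \<Longrightarrow> e \<^bold>\<and> c = c"
  shows "boolean_algebra_on (center S) (skew_meet S) (skew_join S) (skew_diff S e) \<^bold>0 e"
proof
  fix x assume x: "x \<in> center S"
  have cl: "x \<in> carrier S" "e \<in> carrier S" using x e by (simp_all add: center_carrier)
  show xe: "x \<^bold>\<and> e = x" using top[OF x] center_meet_commute[OF e cl(1)] by simp
  have "e \<^bold>\<and> x \<^bold>\<and> e = x" by (simp add: top[OF x] xe)
  then show "x \<^bold>\<and> (e \<setminus> x) = \<^bold>0" "x \<^bold>\<or> (e \<setminus> x) = e"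
    using meet_diff[OF cl(2,1)] diff_join[OF cl(2,1)] by simp_all
qed (blast intro: meet_center join_center diff_center zero_center e meet_assoc join_assoc
    meet_join_distrib center_join_meet_distrib center_carrier center_meet_commute
    center_join_commute join_zero)+

end


section \<open>Primitive algebras\<close>

text \<open>\<open>None\<close> is the zero, and the nonzero elements form a single \<open>\<D>\<close>-class. The left-handed algebra
  also serves the two-sided variety, which contains it.\<close>

definition primitive_skew_ba :: "sidedness \<Rightarrow> 'b option skew_ba" where
  "primitive_skew_ba V = \<lparr>carrier = UNIV,
     skew_meet = (\<lambda>x y. if x = None \<or> y = None then None
       else if V = Right_Handed then y else x),
     skew_join = (\<lambda>x y. if x = None then y else if y = None then x
       else if V = Right_Handed then x else y),
     skew_diff = (\<lambda>x y. if y = None then x else None),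
     skew_zero = None\<rparr>"

lemma primitive_skew_ba_in_variety: "in_variety V (primitive_skew_ba V)"
proof -
  have "skew_boolean_algebra (primitive_skew_ba V)"
    by unfold_locales (auto simp: primitive_skew_ba_def)
  moreover have "V \<noteq> Right_Handed \<Longrightarrow> left_handed (primitive_skew_ba V)"
    "V = Right_Handed \<Longrightarrow> right_handed (primitive_skew_ba V)"
    by (auto simp: left_handed_def right_handed_def primitive_skew_ba_def)
  ultimately show ?thesis by (auto simp: in_variety_def split: sidedness.split)
qed

lemma primitive_meet_eq_None:
  "skew_meet (primitive_skew_ba V) u v = None \<longleftrightarrow> u = None \<or> v = None"
  and primitive_join_eq_None:
  "skew_join (primitive_skew_ba V) u v = None \<longleftrightarrow> u = None \<and> v = None"
  and primitive_diff_eq_None: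
  "skew_diff (primitive_skew_ba V) u v = None \<longleftrightarrow> u = None \<or> v \<noteq> None"
  and primitive_zero: "skew_zero (primitive_skew_ba V) = None"
  by (auto simp: primitive_skew_ba_def)

lemma primitive_meet_commute:
  "skew_meet (primitive_skew_ba V) u v = skew_meet (primitive_skew_ba V) v u \<longleftrightarrow>
     u = None \<or> v = None \<or> u = v"
  by (auto simp: primitive_skew_ba_def)

lemma center_hom_primitive_None:
  fixes S (structure)
  assumes S: "skew_boolean_algebra S" and c: "c \<in> center S"
    and h: "h \<in> skew_ba_hom S (primitive_skew_ba V)"
    and xy: "x \<in> carrier S" "y \<in> carrier S" "h x \<noteq> None" "h y \<noteq> None" "h x \<noteq> h y"
  shows "h c = None"
proof -
  interpret skew_boolean_algebra S by (rule S)
  have "h c = None \<or> h c = h z" if "z \<in> carrier S" "h z \<noteq> None" for z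
    using arg_cong[OF center_meet_commute[OF c that(1)], of h] that c
    by (simp add: skew_ba_homD(2)[OF h] center_carrier primitive_meet_commute)
  then show ?thesis using xy by metis
qed


section \<open>Free skew Boolean algebras\<close>

lemma free_skew_ba_hom_exists:
  assumes "free_skew_ba V S X" "in_variety V B" "f \<in> X \<rightarrow> carrier B"
  obtains h where "h \<in> skew_ba_hom S B" "\<And>x. x \<in> X \<Longrightarrow> h x = f x"
  by (rule universal_atE[OF free_skew_ba_universal[OF assms(1)] assms(2,3)])
    (rule that, assumption, blast)

text \<open>The elements with property \<open>P\<close> form a subalgebra that contains the generators. The universal
  property maps \<open>S\<close> into it, and by uniqueness that map is the identity.\<close>

lemma free_skew_ba_induct [consumes 2, case_names gen zero meet join diff]:
  fixes S :: "'a skew_ba" (structure)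
  assumes free: "free_skew_ba V S X" and s: "s \<in> carrier S"
    and gen: "\<And>x. x \<in> X \<Longrightarrow> P x" and zero: "P (\<^bold>0)"
    and meet: "\<And>s t. \<lbrakk>s \<in> carrier S; t \<in> carrier S; P s; P t\<rbrakk> \<Longrightarrow> P (s \<^bold>\<and> t)"
    and join: "\<And>s t. \<lbrakk>s \<in> carrier S; t \<in> carrier S; P s; P t\<rbrakk> \<Longrightarrow> P (s \<^bold>\<or> t)"
    and diff: "\<And>s t. \<lbrakk>s \<in> carrier S; t \<in> carrier S; P s; P t\<rbrakk> \<Longrightarrow> P (s \<setminus> t)"
  shows "P s"
proof -
  have S: "in_variety V S" and X: "X \<subseteq> carrier S" using free by (auto simp: free_skew_ba_def)
  interpret skew_boolean_algebra S using S by (simp add: in_variety_def)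
  let ?B = "S\<lparr>carrier := {s \<in> carrier S. P s}\<rparr>"
  have "skew_boolean_algebra ?B"
    by unfold_locales
      (auto simp: closed meet join diff zero meet_absorb_left meet_absorb_right join_absorb_left
        join_absorb_right meet_join_distrib join_meet_distrib zero_meet meet_zero zero_join
        join_zero diff_join meet_diff diff_meet, auto simp: meet_assoc join_assoc)
  then have "in_variety V ?B"
    using S by (auto simp: in_variety_def left_handed_def right_handed_def split: sidedness.splits)
  moreover have "(\<lambda>x. x) \<in> X \<rightarrow> carrier ?B" using X gen by auto
  ultimately obtain h where h: "h \<in> skew_ba_hom S ?B" "\<And>x. x \<in> X \<Longrightarrow> h x = x"
    by (rule free_skew_ba_hom_exists[OF free]) blast
  obtain k where k: "\<forall>h'\<in>skew_ba_hom S S. (\<forall>x\<in>X. h' x = x) \<longrightarrow> (\<forall>s\<in>carrier S. h' s = k s)"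
    by (rule universal_atE[OF free_skew_ba_universal[OF free] S, of "\<lambda>x. x"]) (use X in auto)
  have "h \<in> skew_ba_hom S S" by (rule skew_ba_homI) (use skew_ba_homD[OF h(1)] in simp_all)
  then have "h s = k s" using k h(2) s by blast
  moreover have "s = k s"
    by (rule k[rule_format, of "\<lambda>x. x"]) (auto intro: skew_ba_homI s)
  ultimately show ?thesis using skew_ba_homD(1)[OF h(1) s] by simp
qed

lemma free_skew_ba_term:
  assumes free: "free_skew_ba V S X" and s: "s \<in> carrier S"
  obtains t where "set_skew_term t \<subseteq> X" "s = term_eval S (\<lambda>x. x) t"
proof -
  have "\<exists>t. set_skew_term t \<subseteq> X \<and> s = term_eval S (\<lambda>x. x) t"
    using free s
  proof (induction rule: free_skew_ba_induct)
    case (gen x) then show ?case by (intro exI[of _ "Var x"]) simp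
  next
    case zero then show ?case by (intro exI[of _ Zero]) simp
  next
    case (meet s t)
    then obtain u v where "set_skew_term u \<subseteq> X" "s = term_eval S (\<lambda>x. x) u"
      "set_skew_term v \<subseteq> X" "t = term_eval S (\<lambda>x. x) v" by blast
    then show ?case by (intro exI[of _ "Meet u v"]) simp
  next
    case (join s t)
    then obtain u v where "set_skew_term u \<subseteq> X" "s = term_eval S (\<lambda>x. x) u"
      "set_skew_term v \<subseteq> X" "t = term_eval S (\<lambda>x. x) v" by blast
    then show ?case by (intro exI[of _ "Join u v"]) simp
  next
    case (diff s t)
    then obtain u v where "set_skew_term u \<subseteq> X" "s = term_eval S (\<lambda>x. x) u"
      "set_skew_term v \<subseteq> X" "t = term_eval S (\<lambda>x. x) v" by blast
    then show ?case by (intro exI[of _ "Diff u v"]) simp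
  qed
  then show ?thesis using that by blast
qed

text \<open>Choose \<open>a\<close> below the value of \<open>t\<close> that decides all members of \<open>F\<close>. Deciding is inherited by every
  term over \<open>F\<close>, and the outcome for a compound term is computed from the outcomes for its parts
  exactly as vanishing is computed in a primitive algebra. So a homomorphism with the pattern
  prescribed by \<open>a\<close> on \<open>F\<close> is nonzero precisely at those values of terms over \<open>F\<close> that
  lie above \<open>a\<close> modulo \<open>\<D>\<close>.\<close>

lemma nonzero_term_zero_pattern:
  fixes S :: "'a skew_ba" (structure)
  assumes S: "in_variety V S" and t: "set_skew_term t \<subseteq> F" and F: "finite F" "F \<subseteq> carrier S"
    and nz: "term_eval S (\<lambda>x. x) t \<noteq> \<^bold>0"
  shows "\<exists>Y\<subseteq>F. \<forall>h\<in>skew_ba_hom S (primitive_skew_ba V).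
    (\<forall>x\<in>F. h x \<noteq> None \<longleftrightarrow> x \<in> Y) \<longrightarrow> h (term_eval S (\<lambda>x. x) t) \<noteq> None"
proof -
  interpret skew_boolean_algebra S using S by (simp add: in_variety_def)
  let ?ev = "term_eval S (\<lambda>x. x)"
  have ev: "?ev u \<in> carrier S" if "set_skew_term u \<subseteq> F" for u
    using that F by (intro term_eval_closed[OF S]) auto
  obtain a where a: "a \<in> carrier S" "a \<noteq> \<^bold>0" "a \<^bold>\<and> ?ev t = a"
    and dec: "\<And>x. x \<in> F \<Longrightarrow> a \<^bold>\<and> x \<^bold>\<and> a = \<^bold>0 \<or> a \<^bold>\<and> x \<^bold>\<and> a = a"
    using exists_deciding_element[OF F ev[OF t] nz] by blast
  show ?thesis
  proof (intro exI[of _ "{x \<in> F. a \<^bold>\<and> x \<^bold>\<and> a = a}"] conjI ballI impI)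
    fix h
    assume h: "h \<in> skew_ba_hom S (primitive_skew_ba V)"
      and "\<forall>x\<in>F. h x \<noteq> None \<longleftrightarrow> x \<in> {x \<in> F. a \<^bold>\<and> x \<^bold>\<and> a = a}"
    then have Y: "\<And>x. x \<in> F \<Longrightarrow> h x \<noteq> None \<longleftrightarrow> x \<in> {x \<in> F. a \<^bold>\<and> x \<^bold>\<and> a = a}"
      by blast
    note hom = skew_ba_homD[OF h]
    have "a \<^bold>\<and> ?ev u \<^bold>\<and> a = (if h (?ev u) = None then \<^bold>0 else a)" if "set_skew_term u \<subseteq> F" for u
      using that
    proof (induction u)
      case (Var x)
      then show ?case using dec[of x] Y[of x] by auto
    next
      case Zero
      then show ?case using hom(5) a by (simp add: primitive_zero zero_meet meet_zero)
    next
      case (Meet u v)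
      then have u: "?ev u \<in> carrier S" and v: "?ev v \<in> carrier S"
        and IH: "a \<^bold>\<and> ?ev u \<^bold>\<and> a = (if h (?ev u) = None then \<^bold>0 else a)"
          "a \<^bold>\<and> ?ev v \<^bold>\<and> a = (if h (?ev v) = None then \<^bold>0 else a)"
        using ev by auto
      consider "h (?ev u) = None" | "h (?ev v) = None"
        | "h (?ev u) \<noteq> None" "h (?ev v) \<noteq> None" by blast
      then show ?case
      proof cases
        case 1
        then have "a \<^bold>\<and> ?ev u = \<^bold>0" using IH a u by (simp add: sandwich_zero_iff)
        then have "a \<^bold>\<and> (?ev u \<^bold>\<and> ?ev v) = \<^bold>0"
          using a u v by (simp add: zero_meet flip: meet_assoc)
        then show ?thesis using 1 a u v by (simp add: hom primitive_meet_eq_None zero_meet)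
      next
        case 2
        then have "a \<^bold>\<and> ?ev v = \<^bold>0" using IH a v by (simp add: sandwich_zero_iff)
        then have "a \<^bold>\<and> (?ev u \<^bold>\<and> ?ev v) = \<^bold>0"
          using a u v by (simp add: meet_zero_sandwich)
        then show ?thesis using 2 a u v by (simp add: hom primitive_meet_eq_None zero_meet)
      next
        case 3
        then show ?thesis using IH a u v
          by (simp add: hom primitive_meet_eq_None meet_sandwich_filter)
      qed
    next
      case (Join u v)
      then have "?ev u \<in> carrier S" "?ev v \<in> carrier S" using ev by auto
      then show ?case using Join a
        by (simp add: hom primitive_join_eq_None sandwich_join join_idem zero_join join_zero closed)
    next
      case (Diff u v)
      then have "?ev u \<in> carrier S" "?ev v \<in> carrier S" using ev by auto
      then show ?case using Diff a
        by (auto simp: hom primitive_diff_eq_None sandwich_diff_one sandwich_diff_zero)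
    qed
    from this[OF t] have "a = (if h (?ev t) = None then \<^bold>0 else a)"
      using a(3) meet_idem[OF a(1)] by simp
    then show "h (?ev t) \<noteq> None" using a(2) by metis
  qed auto
qed

lemma center_free_infinite:
  fixes S :: "'a skew_ba" (structure)
  assumes free: "free_skew_ba V S X" and inf: "infinite X"
  shows "center S = {\<^bold>0}"
proof -
  have S: "in_variety V S" and X: "X \<subseteq> carrier S" using free by (auto simp: free_skew_ba_def)
  interpret skew_boolean_algebra S using S by (simp add: in_variety_def)
  have "c = \<^bold>0" if c: "c \<in> center S" for c
  proof (rule ccontr)
    assume nz: "c \<noteq> \<^bold>0"
    obtain t where t: "set_skew_term t \<subseteq> X" "c = term_eval S (\<lambda>x. x) t"
      using free_skew_ba_term[OF free center_carrier[OF c]] .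
    let ?F = "set_skew_term t"
    have F: "finite ?F" by (induction t) auto
    have "\<exists>Y\<subseteq>?F. \<forall>h\<in>skew_ba_hom S (primitive_skew_ba V :: bool option skew_ba).
        (\<forall>x\<in>?F. h x \<noteq> None \<longleftrightarrow> x \<in> Y) \<longrightarrow> h c \<noteq> None"
      unfolding t(2)
      by (rule nonzero_term_zero_pattern[OF S order.refl F order.trans[OF t(1) X]])
        (use nz t(2) in simp)
    then obtain Y where Y: "Y \<subseteq> ?F"
      "\<forall>h\<in>skew_ba_hom S (primitive_skew_ba V :: bool option skew_ba).
        (\<forall>x\<in>?F. h x \<noteq> None \<longleftrightarrow> x \<in> Y) \<longrightarrow> h c \<noteq> None"
      by (elim exE conjE)
    have fresh: "X - A \<noteq> {}" if "finite A" for A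
      using Diff_infinite_finite[OF that inf] infinite_imp_nonempty by blast
    obtain x where x: "x \<in> X" "x \<notin> ?F" using fresh[OF F] by blast
    obtain y where y: "y \<in> X" "y \<notin> ?F" "y \<noteq> x" using fresh[of "insert x ?F"] F by auto
    \<comment> \<open>The values at \<open>x\<close> and \<open>y\<close> are nonzero and distinct; neither generator occurs in \<open>t\<close>, so the
      pattern prescribed by \<open>Y\<close> is unaffected.\<close>
    define f where "f z = (if z = x then Some False
      else if z \<in> ?F - Y then None else Some True)" for z
    obtain h where h: "h \<in> skew_ba_hom S (primitive_skew_ba V)" "\<And>z. z \<in> X \<Longrightarrow> h z = f z"
      by (rule free_skew_ba_hom_exists[OF free primitive_skew_ba_in_variety, of f])
        (auto simp: primitive_skew_ba_def)
    have "h z \<noteq> None \<longleftrightarrow> z \<in> Y" if z: "z \<in> ?F" for z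
    proof -
      have "z \<in> X" "z \<noteq> x" using z x(2) t(1) by auto
      then show ?thesis using z by (auto simp: h(2) f_def)
    qed
    then have "h c \<noteq> None" using Y(2) h(1) by blast
    moreover have "h c = None"
      by (rule center_hom_primitive_None[OF skew_boolean_algebra_axioms c h(1), of x y])
        (use x y X h(2) in \<open>auto simp: f_def\<close>)
    ultimately show False by simp
  qed
  then show ?thesis using zero_center by blast
qed

text \<open>If \<open>c \<^bold>\<and> x \<^bold>\<and> y\<close> were not zero, some zero pattern would keep \<open>c\<close>, \<open>x\<close> and \<open>y\<close> alive together,
  even for a homomorphism that separates \<open>x\<close> from \<open>y\<close>.\<close>

lemma center_meet_generators:
  fixes S :: "'a skew_ba" (structure)
  assumes free: "free_skew_ba V S X" and fin: "finite X" and c: "c \<in> center S"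
    and xy: "x \<in> X" "y \<in> X" "x \<noteq> y"
  shows "c \<^bold>\<and> x \<^bold>\<and> y = \<^bold>0"
proof (rule ccontr)
  have S: "in_variety V S" and X: "X \<subseteq> carrier S" using free by (auto simp: free_skew_ba_def)
  interpret skew_boolean_algebra S using S by (simp add: in_variety_def)
  let ?p = "(c \<^bold>\<and> x) \<^bold>\<and> y"
  have cl: "c \<in> carrier S" "x \<in> carrier S" "y \<in> carrier S"
    using c xy X by (auto simp: center_carrier)
  assume nz: "?p \<noteq> \<^bold>0"
  have p: "?p \<in> carrier S" using cl closed by simp
  obtain t where t: "set_skew_term t \<subseteq> X" "?p = term_eval S (\<lambda>x. x) t"
    using free_skew_ba_term[OF free p] .
  have "\<exists>Y\<subseteq>X. \<forall>h\<in>skew_ba_hom S (primitive_skew_ba V :: bool option skew_ba).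
      (\<forall>x\<in>X. h x \<noteq> None \<longleftrightarrow> x \<in> Y) \<longrightarrow> h ?p \<noteq> None"
    unfolding t(2)
    by (rule nonzero_term_zero_pattern[OF S t(1) fin X]) (use nz t(2) in simp)
  then obtain Y where Y: "Y \<subseteq> X"
    "\<forall>h\<in>skew_ba_hom S (primitive_skew_ba V :: bool option skew_ba).
      (\<forall>x\<in>X. h x \<noteq> None \<longleftrightarrow> x \<in> Y) \<longrightarrow> h ?p \<noteq> None"
    by (elim exE conjE)
  define f where "f z = (if z \<in> Y then Some (z = x) else None)" for z
  obtain h where h: "h \<in> skew_ba_hom S (primitive_skew_ba V)" "\<And>z. z \<in> X \<Longrightarrow> h z = f z"
    by (rule free_skew_ba_hom_exists[OF free primitive_skew_ba_in_variety, of f])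
      (auto simp: primitive_skew_ba_def)
  have "h ?p \<noteq> None" by (rule Y(2)[rule_format, OF h(1)]) (simp add: h(2) f_def)
  then have ne: "h c \<noteq> None" "h x \<noteq> None" "h y \<noteq> None"
    using cl by (simp_all add: skew_ba_homD(2)[OF h(1)] closed primitive_meet_eq_None)
  have "h x \<noteq> h y" using ne(2,3) xy by (auto simp: h(2) f_def split: if_splits)
  then show False
    using center_hom_primitive_None[OF skew_boolean_algebra_axioms c h(1) cl(2,3) ne(2,3)] ne(1)
    by simp
qed


section \<open>The atoms of the center\<close>

text \<open>The elements of \<open>F\<close> are removed from \<open>x\<close> one after another. Maximality characterises the result
  as the largest part of \<open>x\<close> orthogonal to \<open>F\<close>; the clause on homomorphisms later shows that
  for generators of a free algebra it is not zero.\<close>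

lemma exists_relative_complement:
  fixes S :: "'a skew_ba" (structure)
  assumes S: "skew_boolean_algebra S" and B: "skew_boolean_algebra B"
    and F: "finite F" "F \<subseteq> carrier S" and x: "x \<in> carrier S"
  shows "\<exists>a\<in>carrier S. a \<^bold>\<and> x = a \<and> x \<^bold>\<and> a = a \<and>
    (\<forall>y\<in>F. a \<^bold>\<and> y = \<^bold>0) \<and>
    (\<forall>z\<in>carrier S. (\<forall>y\<in>F. z \<^bold>\<and> y = \<^bold>0) \<longrightarrow>
      z \<^bold>\<and> a = z \<^bold>\<and> x) \<and>
    (\<forall>h\<in>skew_ba_hom S B. (\<forall>y\<in>F. h y = skew_zero B) \<longrightarrow> h a = h x)"
  using F
proof (induction F rule: finite_induct)
  case empty
  interpret skew_boolean_algebra S by (rule S)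
  show ?case using x by (intro bexI[of _ x]) (simp_all add: meet_idem)
next
  case (insert y F)
  interpret skew_boolean_algebra S by (rule S)
  obtain a where a: "a \<in> carrier S" "a \<^bold>\<and> x = a" "x \<^bold>\<and> a = a" "\<And>y. y \<in> F \<Longrightarrow> a \<^bold>\<and> y = \<^bold>0"
    and max: "\<And>z. \<lbrakk>z \<in> carrier S; \<And>y. y \<in> F \<Longrightarrow> z \<^bold>\<and> y = \<^bold>0\<rbrakk> \<Longrightarrow> z \<^bold>\<and> a = z \<^bold>\<and> x"
    and hom: "\<And>h. \<lbrakk>h \<in> skew_ba_hom S B; \<And>y. y \<in> F \<Longrightarrow> h y = skew_zero B\<rbrakk>
      \<Longrightarrow> h a = h x"
    using insert by auto
  have y: "y \<in> carrier S" and Fc: "F \<subseteq> carrier S" using insert.prems by auto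
  let ?b = "a \<setminus> y"
  have b: "?b \<in> carrier S" using a y by (simp add: closed)
  have ba: "?b \<^bold>\<and> a = ?b" "a \<^bold>\<and> ?b = ?b" using a y by (simp_all add: diff_le)
  have "?b \<^bold>\<and> x = ?b" using meet_assoc[OF b a(1) x] ba a by simp
  moreover have "x \<^bold>\<and> ?b = ?b" using meet_assoc[OF x a(1) b] ba a by simp
  moreover have "?b \<^bold>\<and> z = \<^bold>0" if "z \<in> insert y F" for z
  proof (cases "z = y")
    case True then show ?thesis using a y by (simp add: diff_meet_right)
  next
    case False
    then show ?thesis using that a(4)[of z] meet_assoc[OF b a(1), of z] Fc ba b
      by (auto simp: meet_zero)
  qed
  moreover have "z \<^bold>\<and> ?b = z \<^bold>\<and> x"
    if "z \<in> carrier S" "\<forall>w\<in>insert y F. z \<^bold>\<and> w = \<^bold>0" for z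
    using that max[of z] meet_diff_maximal[OF a(1) y that(1)] by simp
  moreover have "h ?b = h x"
    if h: "h \<in> skew_ba_hom S B" "\<forall>w\<in>insert y F. h w = skew_zero B" for h
  proof -
    have "h ?b = skew_diff B (h a) (skew_zero B)"
      using h(2) a y by (simp add: skew_ba_homD(4)[OF h(1)])
    then show ?thesis
      using hom[OF h(1)] h(2) skew_boolean_algebra.diff_zero[OF B skew_ba_homD(1)[OF h(1) a(1)]]
      by simp
  qed
  ultimately show ?case using b by (intro bexI[of _ ?b]) blast+
qed

text \<open>For differences \<open>s \<setminus> t\<close>, the element \<open>a\<close> stays below exactly when it is below \<open>s\<close> and orthogonal
  to \<open>t\<close>.\<close>

lemma generators_decide:
  fixes S :: "'a skew_ba" (structure)
  assumes free: "free_skew_ba V S X" and a: "a \<in> carrier S" and s: "s \<in> carrier S"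
    and gen: "\<And>x. x \<in> X \<Longrightarrow>
      a \<^bold>\<and> x = a \<and> x \<^bold>\<and> a = a \<or>
      a \<^bold>\<and> x = \<^bold>0 \<and> x \<^bold>\<and> a = \<^bold>0"
  shows "a \<^bold>\<and> s = a \<and> s \<^bold>\<and> a = a \<or>
    a \<^bold>\<and> s = \<^bold>0 \<and> s \<^bold>\<and> a = \<^bold>0"
proof -
  interpret skew_boolean_algebra S
    using free by (simp add: free_skew_ba_def in_variety_def)
  show ?thesis
    using free s
  proof (induction rule: free_skew_ba_induct)
    case (gen x) then show ?case by (rule assms(4))
  next
    case zero
    then show ?case using a by (simp add: meet_zero zero_meet)
  next
    case (meet s t)
    have "a \<^bold>\<and> (s \<^bold>\<and> t) = (a \<^bold>\<and> s) \<^bold>\<and> t" "(s \<^bold>\<and> t) \<^bold>\<and> a = s \<^bold>\<and> (t \<^bold>\<and> a)"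
      using meet a by (simp_all add: meet_assoc)
    then show ?case using meet a by (auto simp: zero_meet meet_zero)
  next
    case (join s t)
    then show ?case using a
      by (auto simp: meet_join_distrib join_meet_distrib join_idem zero_join join_zero closed)
  next
    case (diff s t)
    let ?d = "s \<setminus> t"
    have d: "?d \<in> carrier S" using diff by (simp add: closed)
    show ?case
    proof (cases "a \<^bold>\<and> s = a \<and> s \<^bold>\<and> a = a \<and> a \<^bold>\<and> t = \<^bold>0")
      case True
      then have "a \<^bold>\<and> ?d = a"
        using meet_diff_maximal[of s t a] a diff by simp
      moreover have "?d \<^bold>\<and> a = a"
      proof -
        let ?m = "s \<^bold>\<and> t \<^bold>\<and> s"
        have m: "?m \<in> carrier S" using diff by (simp add: closed)
        have ta: "t \<^bold>\<and> a = \<^bold>0" using True by (simp only: meet_zero_commute[OF a diff(2)])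
        have "?m \<^bold>\<and> a = s \<^bold>\<and> (t \<^bold>\<and> (s \<^bold>\<and> a))" using a diff(1,2) by (simp add: closed meet_assoc)
        also have "\<dots> = \<^bold>0" using True by (simp only: ta meet_zero[OF diff(1)])
        finally have "?m \<^bold>\<and> a = \<^bold>0" .
        then show ?thesis
          using join_meet_distrib[OF m d a] True zero_join[OF meet_closed[OF d a]]
          by (simp only: diff_join[OF diff(1,2)])
      qed
      ultimately show ?thesis by simp
    next
      case False
      then have "a \<^bold>\<and> s \<^bold>\<and> a = \<^bold>0 \<or> a \<^bold>\<and> t \<^bold>\<and> a = a"
        using diff a by (auto simp: zero_meet meet_idem)
      then have "a \<^bold>\<and> ?d \<^bold>\<and> a = \<^bold>0" using a diff by (simp add: sandwich_diff_zero)
      then have "a \<^bold>\<and> ?d = \<^bold>0" using a d by (simp add: sandwich_zero_iff)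
      then show ?thesis using meet_zero_commute[OF a d] by simp
    qed
  qed
qed

text \<open>The elements \<open>s\<close> with \<open>c \<^bold>\<and> s = d \<^bold>\<and> s\<close> form a subalgebra, hence all of \<open>S\<close>; taking \<open>s = c\<close> and
  \<open>s = d\<close> gives \<open>c = d \<^bold>\<and> c = c \<^bold>\<and> d = d\<close>.\<close>

lemma center_eqI:
  fixes S :: "'a skew_ba" (structure)
  assumes free: "free_skew_ba V S X" and c: "c \<in> center S" and d: "d \<in> center S"
    and eq: "\<And>x. x \<in> X \<Longrightarrow> c \<^bold>\<and> x = d \<^bold>\<and> x"
  shows "c = d"
proof -
  interpret skew_boolean_algebra S
    using free by (simp add: free_skew_ba_def in_variety_def)
  have cl: "c \<in> carrier S" "d \<in> carrier S" using c d by (simp_all add: center_carrier)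
  have all: "c \<^bold>\<and> s = d \<^bold>\<and> s" if "s \<in> carrier S" for s
    using free that
  proof (induction rule: free_skew_ba_induct)
    case (meet s t)
    then show ?case using cl by (simp flip: meet_assoc)
  next
    case (diff s t)
    have "u \<^bold>\<and> (s \<setminus> t) = (u \<^bold>\<and> s) \<^bold>\<and> (s \<setminus> t)" if "u \<in> carrier S" for u
      using that diff by (simp add: meet_assoc closed diff_le)
    then show ?case using diff cl by simp
  qed (simp_all add: eq cl meet_zero meet_join_distrib)
  have "c = d \<^bold>\<and> c" using all[OF cl(1)] cl by (simp add: meet_idem)
  also have "\<dots> = c \<^bold>\<and> d" using d cl(1) by (rule center_meet_commute)
  also have "\<dots> = d" using all[OF cl(2)] cl by (simp add: meet_idem)
  finally show ?thesis .
qed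

lemma center_free_finite:
  fixes S :: "'a skew_ba" (structure)
  assumes free: "free_skew_ba V S X" and fin: "finite X"
  shows "\<exists>e. boolean_algebra_on (center S) (skew_meet S) (skew_join S)
      (skew_diff S e) \<^bold>0 e"
    and "card (center S) = 2 ^ card X"
proof -
  have S: "in_variety V S" and X: "X \<subseteq> carrier S" using free by (auto simp: free_skew_ba_def)
  interpret skew_boolean_algebra S using S by (simp add: in_variety_def)
  let ?P = "primitive_skew_ba V :: unit option skew_ba"
  have P: "in_variety V ?P" "skew_boolean_algebra ?P"
    using primitive_skew_ba_in_variety by (auto simp: in_variety_def)
  have "\<forall>x\<in>X. \<exists>a. a \<in> carrier S \<and> a \<^bold>\<and> x = a \<and> x \<^bold>\<and> a = a \<and>
    (\<forall>y\<in>X - {x}. a \<^bold>\<and> y = \<^bold>0) \<and>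
    (\<forall>z\<in>carrier S. (\<forall>y\<in>X - {x}. z \<^bold>\<and> y = \<^bold>0) \<longrightarrow> z \<^bold>\<and> a = z \<^bold>\<and> x) \<and>
    (\<forall>h\<in>skew_ba_hom S ?P. (\<forall>y\<in>X - {x}. h y = None) \<longrightarrow> h a = h x)"
  proof
    fix x assume "x \<in> X"
    then have x: "x \<in> carrier S" and F: "finite (X - {x})" "X - {x} \<subseteq> carrier S"
      using X fin by auto
    from exists_relative_complement[OF skew_boolean_algebra_axioms P(2) F x]
    show "\<exists>a. a \<in> carrier S \<and> a \<^bold>\<and> x = a \<and> x \<^bold>\<and> a = a \<and>
      (\<forall>y\<in>X - {x}. a \<^bold>\<and> y = \<^bold>0) \<and>
      (\<forall>z\<in>carrier S. (\<forall>y\<in>X - {x}. z \<^bold>\<and> y = \<^bold>0) \<longrightarrow> z \<^bold>\<and> a = z \<^bold>\<and> x) \<and>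
      (\<forall>h\<in>skew_ba_hom S ?P. (\<forall>y\<in>X - {x}. h y = None) \<longrightarrow> h a = h x)"
      unfolding primitive_zero Bex_def .
  qed
  from bchoice[OF this] obtain a where
    a: "\<And>x. x \<in> X \<Longrightarrow> a x \<in> carrier S" "\<And>x. x \<in> X \<Longrightarrow> a x \<^bold>\<and> x = a x"
      "\<And>x. x \<in> X \<Longrightarrow> x \<^bold>\<and> a x = a x"
      "\<And>x y. \<lbrakk>x \<in> X; y \<in> X; y \<noteq> x\<rbrakk> \<Longrightarrow> a x \<^bold>\<and> y = \<^bold>0"
    and max: "\<And>x z. \<lbrakk>x \<in> X; z \<in> carrier S; \<And>y. y \<in> X - {x} \<Longrightarrow> z \<^bold>\<and> y = \<^bold>0\<rbrakk> \<Longrightarrow>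
        z \<^bold>\<and> a x = z \<^bold>\<and> x"
    and hom: "\<And>x h. \<lbrakk>x \<in> X; h \<in> skew_ba_hom S ?P; \<And>y. y \<in> X - {x} \<Longrightarrow> h y = None\<rbrakk> \<Longrightarrow>
        h (a x) = h x"
    by (simp add: Ball_def) blast
  \<comment> \<open>The homomorphism that kills all generators except \<open>x\<close> does not kill \<open>a x\<close>.\<close>
  have a_nz: "a x \<noteq> \<^bold>0" if x: "x \<in> X" for x
  proof -
    obtain h where h: "h \<in> skew_ba_hom S ?P"
      "\<And>z. z \<in> X \<Longrightarrow> h z = (if z = x then Some () else None)"
      by (rule free_skew_ba_hom_exists[OF free P(1), of "\<lambda>z. if z = x then Some () else None"])
        (auto simp: primitive_skew_ba_def)
    have "h (a x) = Some ()" using hom[OF x h(1)] h(2) x by simp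
    then show ?thesis using skew_ba_homD(5)[OF h(1)] by (auto simp: primitive_zero)
  qed
  have a_decide: "a x \<^bold>\<and> s = a x \<and> s \<^bold>\<and> a x = a x \<or> a x \<^bold>\<and> s = \<^bold>0 \<and> s \<^bold>\<and> a x = \<^bold>0"
    if x: "x \<in> X" and s: "s \<in> carrier S" for x s
    using free a(1)[OF x] s
  proof (rule generators_decide)
    fix y assume "y \<in> X"
    then show "a x \<^bold>\<and> y = a x \<and> y \<^bold>\<and> a x = a x \<or> a x \<^bold>\<and> y = \<^bold>0 \<and> y \<^bold>\<and> a x = \<^bold>0"
      using a[OF x] a(2,3)[of y] X meet_zero_commute[OF a(1)[OF x], of y] by (cases "y = x") auto
  qed
  have a_center: "a x \<in> center S" if "x \<in> X" for x
    unfolding center_iff using a(1)[OF that] a_decide[OF that] by metis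
  have a_orth: "a x \<^bold>\<and> a y = \<^bold>0" if "x \<in> X" "y \<in> X" "x \<noteq> y" for x y
  proof -
    have "a x \<^bold>\<and> a y = a x \<^bold>\<and> (y \<^bold>\<and> a y)" using a that by simp
    also have "\<dots> = (a x \<^bold>\<and> y) \<^bold>\<and> a y"
      using meet_assoc[OF a(1)[OF that(1)] subsetD[OF X that(2)] a(1)[OF that(2)]] by simp
    also have "\<dots> = \<^bold>0" using a that by (simp add: zero_meet)
    finally show ?thesis .
  qed
  have meet_gen: "c \<^bold>\<and> x = c \<^bold>\<and> a x" if c: "c \<in> center S" and x: "x \<in> X" for c x
  proof -
    have cl: "c \<in> carrier S" "x \<in> carrier S" using c x X by (auto simp: center_carrier)
    have "(c \<^bold>\<and> x) \<^bold>\<and> a x = (c \<^bold>\<and> x) \<^bold>\<and> x"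
      by (rule max[OF x]) (use cl closed center_meet_generators[OF free fin c x] in auto)
    then show ?thesis using cl a(1,3)[OF x] by (simp add: meet_assoc meet_idem)
  qed
  define supp where "supp c = {x \<in> X. c \<^bold>\<and> a x = a x}" for c
  have supp_eq: "c \<^bold>\<and> a x = (if x \<in> supp c then a x else \<^bold>0)"
    if "c \<in> center S" "x \<in> X" for c x
    using a_decide[OF that(2) center_carrier[OF that(1)]] a_nz[OF that(2)] that(2)
    by (auto simp: supp_def)
  have inj: "c = d" if "c \<in> center S" "d \<in> center S" "supp c = supp d" for c d
    by (rule center_eqI[OF free that(1,2)]) (simp add: meet_gen supp_eq that)
  have surj: "\<exists>c\<in>center S. supp c = A" if "A \<subseteq> X" for A
    using finite_subset[OF that fin] that
  proof (induction A rule: finite_induct)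
    case empty
    have "supp \<^bold>0 = {}" by (auto simp: supp_def zero_meet a(1)) (metis a_nz)
    then show ?case using zero_center by blast
  next
    case (insert x A)
    then obtain c where c: "c \<in> center S" "supp c = A" by auto
    have x: "x \<in> X" using insert.prems by simp
    have "(c \<^bold>\<or> a x) \<^bold>\<and> a y = (if y \<in> insert x A then a y else \<^bold>0)" if y: "y \<in> X" for y
    proof -
      have "(c \<^bold>\<or> a x) \<^bold>\<and> a y = (c \<^bold>\<and> a y) \<^bold>\<or> (a x \<^bold>\<and> a y)"
        using center_carrier[OF c(1)] a(1)[OF x] a(1)[OF y] by (rule join_meet_distrib)
      then show ?thesis
        using supp_eq[OF c(1) y] c(2) a_orth[OF x y] a(1)[OF y] insert.hyps
        by (cases "y = x") (auto simp: meet_idem zero_join join_zero zero_closed)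
    qed
    then have "supp (c \<^bold>\<or> a x) = insert x A"
      using insert.prems a_nz unfolding supp_def by (auto split: if_splits) (metis a_nz)+
    then show ?case using join_center[OF c(1) a_center[OF x]] by blast
  qed
  have "bij_betw supp (center S) (Pow X)"
    unfolding bij_betw_def
  proof
    show "inj_on supp (center S)" using inj by (auto intro: inj_onI)
    show "supp ` center S = Pow X" using surj by (auto simp: supp_def)
  qed
  then show "card (center S) = 2 ^ card X"
    using bij_betw_same_card card_Pow[OF fin] by metis
  obtain e where e: "e \<in> center S" "supp e = X" using surj by blast
  have "e \<^bold>\<and> c = c" if c: "c \<in> center S" for c
  proof (rule inj)
    show "e \<^bold>\<and> c \<in> center S" using e(1) c by (rule meet_center)
    have "(e \<^bold>\<and> c) \<^bold>\<and> a x = c \<^bold>\<and> a x" if x: "x \<in> X" for x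
      using meet_assoc[OF center_carrier[OF e(1)] center_carrier[OF c] a(1)[OF x]]
        supp_eq[OF c x] supp_eq[OF e(1) x] e(2) x center_carrier[OF e(1)]
      by (simp add: meet_zero)
    then show "supp (e \<^bold>\<and> c) = supp c" by (auto simp: supp_def)
  qed (rule c)
  then show "\<exists>e. boolean_algebra_on (center S) (skew_meet S) (skew_join S)
      (skew_diff S e) \<^bold>0 e"
    using center_boolean_algebra[OF e(1)] by blast
qed

theorem theorem6p3:
  fixes V :: sidedness and S :: "'a skew_ba" and X :: "'a set"
  assumes "free_skew_ba V S X"
  shows "(\<forall>n::nat. n \<ge> 1 \<longrightarrow> finite X \<longrightarrow> card X = n \<longrightarrow>
            (\<exists>e. boolean_algebra_on (center S) (skew_meet S) (skew_join S)
                   (skew_diff S e) (skew_zero S) e) \<and>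
            card (center S) = 2 ^ n) \<and>
         (infinite X \<longrightarrow> center S = {skew_zero S})"
  using center_free_finite[OF assms] center_free_infinite[OF assms] by blast

end
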